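(* Let $Q$ be a well quasi-order. Then $\mathbf{w}(T(Q))=\mathbf{o}(T(Q))$; if $\mathbf{o}(Q)>1$ then $\mathbf{w}(Q^{<\omega})=\mathbf{o}(Q^{<\omega})$; and if $\mathbf{o}(Q)>1$ is an additive principal ordinal then $\mathbf{w}(M(Q))=\mathbf{o}(M(Q))$.
   Context: A well quasi-order is a quasi-order with no infinite strictly decreasing sequences and no infinite antichains. For a tree of non-empty finite sequences ordered by strict initial segment $\sqsubset$ with no infinite branch, its rank is the least ordinal $\gamma$ admitting $f$ into $\gamma$ with $s\sqsubset t\implies f(s)>f(t)$. For a well quasi-order $X$, $\mathbf{w}(X)$ is the rank of the tree of non-empty sequences of pairwise incomparable elements, and $\mathbf{o}(X)$ the rank of the tree of non-empty bad sequences ($x_i\not\le x_j$ for all $i<j$). An ordinal $\alpha$ is additive principal if $\beta,\gamma<\alpha$ implies $\beta+\gamma<\alpha$. $Q^{<\omega}$: finite sequences with subsequence embedding, $\langle x_0,\dots,x_{n-1}\rangle\le_*\langle x'_0,\dots,x'_{p-1}\rangle$ iff some strictly increasing $f:n\to p$ has $x_i\le x'_{f(i)}$ for all $i$. $M(Q)$: finite multisets with $\{x_0,\dots,x_{n-1}\}\le\{x'_0,\dots,x'_{p-1}\}$ iff some injective $f:n\to p$ has $x_i\le x'_{f(i)}$. $T(Q)$: finite rooted ordered trees with labels in $Q$ (terms $x(t_1,\dots,t_n)$, $n\ge0$), with homeomorphic embedding: $x(t_1,\dots,t_n)\le_T x'(t'_1,\dots,t'_p)$ iff $x(t_1,\dots,t_n)\le_T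 t'_j$ for some $j$, or $x\le x'$ and $t_1\cdots t_n\le_* t'_1\cdots t'_p$ in the subsequence embedding over $(T(Q),\le_T)$. *)

theory Defs
  imports Complex_Main "HOL-Library.Sublist" "HOL-Library.Multiset"
begin

unbundle cardinal_syntax

section \<open>Ordinals\<close>

text \<open>
  An ordinal is represented by a well-order, a relation \<open>r :: 'b rel\<close> with \<^term>\<open>Well_order r\<close>;
  equality, \<open>\<le>\<close> and \<open><\<close> of ordinals are \<^term>\<open>ordIso\<close>, \<^term>\<open>ordLeq\<close> and \<^term>\<open>ordLess\<close>
  (\<open>=o\<close>, \<open>\<le>o\<close>, \<open><o\<close>), and the finite ordinal \<open>n\<close> is \<open>natLeq_on n\<close>.
\<close>

definition ord_sum :: "'b rel \<Rightarrow> 'c rel \<Rightarrow> ('b + 'c) rel" where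
  "ord_sum r s =
     {(Inl x, Inl y) | x y. (x, y) \<in> r} \<union>
     {(Inr x, Inr y) | x y. (x, y) \<in> s} \<union>
     {(Inl x, Inr y) | x y. x \<in> Field r \<and> y \<in> Field s}"

text \<open>
  Every ordinal below \<open>\<alpha>\<close> is isomorphic to an initial segment of \<open>\<alpha>\<close>, so it is no restriction that
  \<open>\<beta>\<close> and \<open>\<gamma>\<close> live on the same type as \<open>\<alpha>\<close>.
\<close>

definition additive_principal :: "'b rel \<Rightarrow> bool" where
  "additive_principal \<alpha> \<longleftrightarrow>
     Well_order \<alpha> \<and> (\<forall>(\<beta> :: 'b rel) (\<gamma> :: 'b rel). \<beta> <o \<alpha> \<longrightarrow> \<gamma> <o \<alpha> \<longrightarrow> ord_sum \<beta> \<gamma> <o \<alpha>)"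

section \<open>Ranks of trees of finite sequences\<close>

definition ranks_into :: "'x list set \<Rightarrow> 'b rel \<Rightarrow> bool" where
  "ranks_into T \<gamma> \<longleftrightarrow> Well_order \<gamma> \<and>
     (\<exists>f. (\<forall>s\<in>T. f s \<in> Field \<gamma>) \<and>
          (\<forall>s\<in>T. \<forall>t\<in>T. strict_prefix s t \<longrightarrow> (f t, f s) \<in> \<gamma> - Id))"

text \<open>
  The rank is determined up to order isomorphism.  It is represented on the type of the nodes, which
  is large enough: see \<open>tree_rank_least\<close> below.
\<close>

definition tree_rank :: "'x list set \<Rightarrow> 'x list rel" where
  "tree_rank T = (SOME \<gamma>. ranks_into T \<gamma> \<and> (\<forall>\<delta> :: 'x list rel. ranks_into T \<delta> \<longrightarrow> \<gamma> \<le>o \<delta>))"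

text \<open>
  For well-founded \<open>R\<close>, \<open>rank_le s t\<close> says that the rank of \<open>s\<close> is at most the rank of \<open>t\<close>; breaking
  ties by an arbitrary well-order gives a well-order extending \<open>R\<close>, hence \<open>tree_rank_least\<close>.
\<close>

context
  fixes R :: "'x rel"
begin

coinductive rank_le :: "'x \<Rightarrow> 'x \<Rightarrow> bool" where
  "(\<And>s'. (s', s) \<in> R \<Longrightarrow> \<exists>t'. (t', t) \<in> R \<and> rank_le s' t') \<Longrightarrow> rank_le s t"

lemma rank_le_refl: "rank_le s s"
proof -
  have "s = t \<Longrightarrow> rank_le s t" for s t
    by (coinduction arbitrary: s t rule: rank_le.coinduct) auto
  then show ?thesis by simp
qed

lemma rank_leD: "rank_le s t \<Longrightarrow> (s', s) \<in> R \<Longrightarrow> \<exists>t'. (t', t) \<in> R \<and> rank_le s' t'"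
  by (auto elim: rank_le.cases)

lemma rank_le_trans: "rank_le s t \<Longrightarrow> rank_le t u \<Longrightarrow> rank_le s u"
proof -
  have "(\<exists>t. rank_le s t \<and> rank_le t u) \<Longrightarrow> rank_le s u" for s u
    by (coinduction arbitrary: s u rule: rank_le.coinduct) (metis rank_leD)
  then show "rank_le s t \<Longrightarrow> rank_le t u \<Longrightarrow> rank_le s u" by blast
qed

lemma rank_le_total:
  assumes "wf R"
  shows "rank_le s t \<or> rank_le t s"
  using assms
proof (induction s arbitrary: t rule: wf_induct_rule)
  case (less s)
  then show ?case by (metis rank_le.intros)
qed

lemma rank_le_strict:
  assumes "wf R"
  shows "(s, t) \<in> R \<Longrightarrow> \<not> rank_le t s"
  using assms
proof (induction s arbitrary: t rule: wf_induct_rule)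
  case (less s)
  then show ?case by (metis rank_leD)
qed

lemma wf_rank_less:
  assumes "wf R"
  shows "wf {(s, t). \<not> rank_le t s}" (is "wf ?L")
proof -
  have rank_lessD: "\<not> rank_le t s \<Longrightarrow> \<exists>t'. (t', t) \<in> R \<and> rank_le s t'" for s t
    using assms
  proof (induction t arbitrary: s rule: wf_induct_rule)
    case (less t)
    then obtain t' where "(t', t) \<in> R" "\<And>s'. (s', s) \<in> R \<Longrightarrow> \<not> rank_le t' s'"
      by (metis rank_le.intros)
    then show ?case using less.IH by (metis rank_le.intros)
  qed
  have "\<forall>s. rank_le s t \<longrightarrow> s \<in> Wellfounded.acc ?L" for t
    using assms
  proof (induction t rule: wf_induct_rule)
    case (less t)
    show ?case
    proof (intro allI impI)
      fix s assume s: "rank_le s t"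
      show "s \<in> Wellfounded.acc ?L"
      proof (rule accI)
        fix u assume "(u, s) \<in> ?L"
        then have "\<not> rank_le t u" using s rank_le_trans by blast
        then show "u \<in> Wellfounded.acc ?L"
          using less.IH rank_lessD by blast
      qed
    qed
  qed
  then have "\<forall>t. t \<in> Wellfounded.acc ?L" using rank_le_refl by blast
  then show ?thesis by (rule acc_wfI)
qed

end

lemma wf_extends_to_Well_order:
  fixes R :: "'x rel"
  assumes "wf R"
  shows "\<exists>W :: 'x rel. Well_order W \<and> Field W = UNIV \<and> R \<subseteq> W - Id"
proof -
  obtain V :: "'x rel" where V: "Well_order V" "Field V = UNIV"
    using Zorn.well_ordering by (elim exE conjE)
  let ?le = "rank_le R"
  define W where "W = {(s, t). \<not> ?le t s \<or> ?le s t \<and> ?le t s \<and> (s, t) \<in> V}"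
  have Vp: "refl V" "trans V" "antisym V" "total V" "wf (V - Id)"
    using V by (auto simp: well_order_on_def linear_order_on_def partial_order_on_def preorder_on_def)
  note tot = rank_le_total[OF assms] and tr = rank_le_trans[of R]
  have "refl W"
    using rank_le_refl[of R] reflD[OF Vp(1)] by (simp add: W_def refl_on_def)
  then have F: "Field W = UNIV"
    by (auto simp: refl_on_def Field_def)
  note \<open>refl W\<close>
  moreover have "trans W"
  proof (rule transI)
    fix x y z assume xy: "(x, y) \<in> W" and yz: "(y, z) \<in> W"
    then have "?le x y" "?le y z" using tot[of x y] tot[of y z] by (auto simp: W_def)
    then have "?le x z" by (rule tr)
    moreover have "(x, z) \<in> V" if "?le z x"
    proof -
      have "?le y x" "?le z y"
        using tr[OF \<open>?le y z\<close> that] tr[OF that \<open>?le x y\<close>] by simp_all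
      then show ?thesis using xy yz \<open>?le x y\<close> \<open>?le y z\<close> transD[OF Vp(2), of x y z] by (simp add: W_def)
    qed
    ultimately show "(x, z) \<in> W" by (auto simp: W_def)
  qed
  moreover have "antisym W"
  proof (rule antisymI)
    fix x y assume "(x, y) \<in> W" "(y, x) \<in> W"
    then have "(x, y) \<in> V" "(y, x) \<in> V" using tot[of x y] by (auto simp: W_def)
    then show "x = y" by (rule antisymD[OF Vp(3)])
  qed
  moreover have "total W"
  proof (rule total_onI)
    fix x y :: 'x assume "x \<noteq> y"
    then have "(x, y) \<in> V \<or> (y, x) \<in> V" using Vp(4) by (simp add: total_on_def)
    then show "(x, y) \<in> W \<or> (y, x) \<in> W" using tot[of x y] by (auto simp: W_def)
  qed
  moreover have "wf (W - Id)"
  proof (rule wfI_min)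
    fix x :: 'x and Q assume "x \<in> Q"
    then have "\<exists>m\<in>Q. \<forall>y. (y, m) \<in> {(s, t). \<not> ?le t s} \<longrightarrow> y \<notin> Q"
      by (rule wf_rank_less[OF assms, unfolded wf_eq_minimal, rule_format])
    then obtain m where m: "m \<in> Q" "\<forall>y. (y, m) \<in> {(s, t). \<not> ?le t s} \<longrightarrow> y \<notin> Q"
      by (rule bexE)
    have "m \<in> {q \<in> Q. ?le q m}" using m(1) rank_le_refl[of R m] by simp
    then have "\<exists>z\<in>{q \<in> Q. ?le q m}. \<forall>y. (y, z) \<in> V - Id \<longrightarrow> y \<notin> {q \<in> Q. ?le q m}"
      by (rule Vp(5)[unfolded wf_eq_minimal, rule_format])
    then obtain z where z: "z \<in> {q \<in> Q. ?le q m}"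
        "\<forall>y. (y, z) \<in> V - Id \<longrightarrow> y \<notin> {q \<in> Q. ?le q m}"
      by (rule bexE)
    have "y \<notin> Q" if y: "(y, z) \<in> W - Id" for y
    proof
      assume "y \<in> Q"
      then have "?le m y" using m(2) by auto
      then have "?le z y" using z(1) tr[of z m y] by simp
      then have "?le y z" "(y, z) \<in> V - Id" using y by (auto simp: W_def)
      then show False using z(1) z(2)[rule_format, of y] \<open>y \<in> Q\<close> tr[of y z m] by simp
    qed
    then show "\<exists>z\<in>Q. \<forall>y. (y, z) \<in> W - Id \<longrightarrow> y \<notin> Q" using z(1) by auto
  qed
  ultimately have "Well_order W"
    by (simp add: F well_order_on_def linear_order_on_def partial_order_on_def preorder_on_def)
  moreover have "R \<subseteq> W - Id"
  proof (rule subsetI, clarify)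
    fix s t assume "(s, t) \<in> R"
    then have "\<not> ?le t s" by (rule rank_le_strict[OF assms])
    then show "(s, t) \<in> W - Id" using rank_le_refl[of R t] by (auto simp: W_def)
  qed
  ultimately show ?thesis using F by (intro exI[of _ W] conjI)
qed

lemma ranks_into_ordIso:
  assumes "ranks_into T \<gamma>" "\<gamma> =o \<delta>"
  shows "ranks_into T \<delta>"
proof -
  obtain f where f: "\<forall>s\<in>T. f s \<in> Field \<gamma>"
      "\<forall>s\<in>T. \<forall>t\<in>T. strict_prefix s t \<longrightarrow> (f t, f s) \<in> \<gamma> - Id"
    using assms(1) by (auto simp: ranks_into_def)
  obtain g where g: "bij_betw g (Field \<gamma>) (Field \<delta>)"
      "\<forall>a\<in>Field \<gamma>. \<forall>b\<in>Field \<gamma>. (a, b) \<in> \<gamma> \<longleftrightarrow> (g a, g b) \<in> \<delta>"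
    using assms(2) by (auto simp: ordIso_def iso_iff2)
  have "\<forall>s\<in>T. g (f s) \<in> Field \<delta>"
    using f g by (auto simp: bij_betw_def)
  moreover have "\<forall>s\<in>T. \<forall>t\<in>T. strict_prefix s t \<longrightarrow> (g (f t), g (f s)) \<in> \<delta> - Id"
    using f g by (auto simp: bij_betw_def inj_on_eq_iff)
  moreover have "Well_order \<delta>"
    using assms(2) by (simp add: ordIso_def)
  ultimately show ?thesis
    unfolding ranks_into_def by (intro conjI exI[of _ "\<lambda>s. g (f s)"]) auto
qed

lemma tree_rank_least:
  fixes T :: "'x list set" and \<delta> :: "'b rel"
  assumes "\<nexists>b :: nat \<Rightarrow> 'x list. \<forall>i. b i \<in> T \<and> strict_prefix (b i) (b (Suc i))"
  shows "ranks_into T (tree_rank T)"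
    and "ranks_into T \<delta> \<Longrightarrow> tree_rank T \<le>o \<delta>"
proof -
  let ?R = "{(t, s). s \<in> T \<and> t \<in> T \<and> strict_prefix s t}"
  have "wf ?R"
    unfolding wf_iff_no_infinite_down_chain
  proof
    assume "\<exists>b. \<forall>i. (b (Suc i), b i) \<in> ?R"
    then obtain b where "\<forall>i. (b (Suc i), b i) \<in> ?R" by (rule exE)
    then have "\<forall>i. b i \<in> T \<and> strict_prefix (b i) (b (Suc i))" by simp
    then have "\<exists>b. \<forall>i. b i \<in> T \<and> strict_prefix (b i) (b (Suc i))" by (rule exI[of _ b])
    with assms show False by (rule notE)
  qed
  then obtain W :: "'x list rel" where "Well_order W" "Field W = UNIV" "?R \<subseteq> W - Id"
    by (elim wf_extends_to_Well_order[THEN exE] conjE)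
  have "\<forall>s\<in>T. \<forall>t\<in>T. strict_prefix s t \<longrightarrow> (t, s) \<in> W - Id"
  proof (intro ballI impI)
    fix s t assume "s \<in> T" "t \<in> T" "strict_prefix s t"
    then have "(t, s) \<in> ?R" by simp
    with \<open>?R \<subseteq> W - Id\<close> show "(t, s) \<in> W - Id" by (rule subsetD)
  qed
  then have "ranks_into T W"
    unfolding ranks_into_def using \<open>Well_order W\<close> \<open>Field W = UNIV\<close>
    by (intro conjI exI[of _ "\<lambda>s. s"]) simp_all
  then have "{\<gamma> :: 'x list rel. ranks_into T \<gamma>} \<noteq> {}" by auto
  moreover have "\<forall>\<gamma> \<in> {\<gamma> :: 'x list rel. ranks_into T \<gamma>}. Well_order \<gamma>"
    by (simp add: ranks_into_def)
  ultimately have "\<exists>\<gamma> \<in> {\<gamma> :: 'x list rel. ranks_into T \<gamma>}.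
      \<forall>\<delta> \<in> {\<delta> :: 'x list rel. ranks_into T \<delta>}. \<gamma> \<le>o \<delta>"
    by (rule exists_minim_Well_order)
  then have "\<exists>\<gamma> :: 'x list rel. ranks_into T \<gamma> \<and> (\<forall>\<delta> :: 'x list rel. ranks_into T \<delta> \<longrightarrow> \<gamma> \<le>o \<delta>)"
    by simp
  then have *: "ranks_into T (tree_rank T) \<and>
      (\<forall>\<delta> :: 'x list rel. ranks_into T \<delta> \<longrightarrow> tree_rank T \<le>o \<delta>)"
    unfolding tree_rank_def by (rule someI_ex)
  then show "ranks_into T (tree_rank T)" by blast
  show "tree_rank T \<le>o \<delta>" if "ranks_into T \<delta>"
  proof (rule ccontr)
    assume "\<not> tree_rank T \<le>o \<delta>"
    then have "\<delta> <o tree_rank T"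
      using conjunct1[OF *] that by (simp add: ranks_into_def not_ordLeq_iff_ordLess)
    then obtain \<gamma> :: "'x list rel" where "\<delta> =o \<gamma>" "\<gamma> <o tree_rank T"
      unfolding internalize_ordLess[of \<delta>] by (elim exE conjE)
    then show False
      using * ranks_into_ordIso[OF that, of \<gamma>] not_ordLess_ordLeq[of \<gamma> "tree_rank T"] by simp
  qed
qed

section \<open>Well quasi-orders, width and maximal order type\<close>

definition quasi_order_on :: "'x set \<Rightarrow> ('x \<Rightarrow> 'x \<Rightarrow> bool) \<Rightarrow> bool" where
  "quasi_order_on A le \<longleftrightarrow> reflp_on A le \<and> transp_on A le"

definition well_quasi_order_on :: "'x set \<Rightarrow> ('x \<Rightarrow> 'x \<Rightarrow> bool) \<Rightarrow> bool" where
  "well_quasi_order_on A le \<longleftrightarrow> quasi_order_on A le \<and>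
     (\<nexists>x :: nat \<Rightarrow> 'x. \<forall>i. x i \<in> A \<and> le (x (Suc i)) (x i) \<and> \<not> le (x i) (x (Suc i))) \<and>
     (\<nexists>B. B \<subseteq> A \<and> infinite B \<and> (\<forall>x\<in>B. \<forall>y\<in>B. x \<noteq> y \<longrightarrow> \<not> le x y))"

definition incomparable_seqs :: "'x set \<Rightarrow> ('x \<Rightarrow> 'x \<Rightarrow> bool) \<Rightarrow> 'x list set" where
  "incomparable_seqs A le = {xs. xs \<noteq> [] \<and> set xs \<subseteq> A \<and>
     (\<forall>i j. i < j \<and> j < length xs \<longrightarrow> \<not> le (xs ! i) (xs ! j) \<and> \<not> le (xs ! j) (xs ! i))}"

definition bad_seqs :: "'x set \<Rightarrow> ('x \<Rightarrow> 'x \<Rightarrow> bool) \<Rightarrow> 'x list set" where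
  "bad_seqs A le = {xs. xs \<noteq> [] \<and> set xs \<subseteq> A \<and>
     (\<forall>i j. i < j \<and> j < length xs \<longrightarrow> \<not> le (xs ! i) (xs ! j))}"

definition ord_width :: "'x set \<Rightarrow> ('x \<Rightarrow> 'x \<Rightarrow> bool) \<Rightarrow> 'x list rel" where
  "ord_width A le = tree_rank (incomparable_seqs A le)"

definition max_order_type :: "'x set \<Rightarrow> ('x \<Rightarrow> 'x \<Rightarrow> bool) \<Rightarrow> 'x list rel" where
  "max_order_type A le = tree_rank (bad_seqs A le)"

section \<open>Sequences, multisets and trees over a quasi-order\<close>

text \<open>The carrier of the finite sequences over \<open>Q\<close> is \<^term>\<open>lists Q\<close>, ordered by \<^term>\<open>list_emb\<close>.\<close>

lemma list_emb_iff_strict_mono: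
  "list_emb le xs ys \<longleftrightarrow>
     (\<exists>f. strict_mono_on {..<length xs} f \<and>
          (\<forall>i<length xs. f i < length ys \<and> le (xs ! i) (ys ! f i)))"
  (is "_ \<longleftrightarrow> ?emb xs ys")
proof
  show "list_emb le xs ys \<Longrightarrow> ?emb xs ys"
  proof (induction rule: list_emb.induct)
    case (list_emb_Nil ys)
    show ?case by (auto simp: strict_mono_on_def)
  next
    case (list_emb_Cons xs ys y)
    then obtain f where "strict_mono_on {..<length xs} f"
        "\<forall>i<length xs. f i < length ys \<and> le (xs ! i) (ys ! f i)"
      by blast
    then show ?case
      by (intro exI[of _ "\<lambda>i. Suc (f i)"]) (auto simp: strict_mono_on_def)
  next
    case (list_emb_Cons2 x y xs ys)
    then obtain f where "strict_mono_on {..<length xs} f"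
        "\<forall>i<length xs. f i < length ys \<and> le (xs ! i) (ys ! f i)"
      by blast
    then show ?case using \<open>le x y\<close>
      by (intro exI[of _ "case_nat 0 (\<lambda>i. Suc (f i))"])
         (auto simp: strict_mono_on_def nth_Cons split: nat.splits)
  qed
  show "?emb xs ys \<Longrightarrow> list_emb le xs ys"
  proof (induction ys arbitrary: xs)
    case Nil
    then show ?case by (cases xs) auto
  next
    case (Cons y ys)
    show ?case
    proof (cases xs)
      case Nil
      then show ?thesis by simp
    next
      case xs: (Cons x xs')
      obtain f where "strict_mono_on {..<length xs} f"
          "\<forall>i<length xs. f i < length (y # ys) \<and> le (xs ! i) ((y # ys) ! f i)"
        using Cons.prems by blast
      then have f: "\<And>i j. i < length xs \<Longrightarrow> j < length xs \<Longrightarrow> i < j \<Longrightarrow> f i < f j"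
          "\<And>i. i < length xs \<Longrightarrow> f i < Suc (length ys) \<and> le (xs ! i) ((y # ys) ! f i)"
        by (auto simp: strict_mono_on_def)
      show ?thesis
      proof (cases "f 0 = 0")
        case True
        have pos: "0 < f (Suc i)" if "i < length xs'" for i
          using f(1)[of 0 "Suc i"] that xs by simp
        have "?emb xs' ys"
        proof (intro exI[of _ "\<lambda>i. f (Suc i) - 1"] conjI allI impI)
          show "strict_mono_on {..<length xs'} (\<lambda>i. f (Suc i) - 1)"
          proof (rule strict_mono_onI)
            fix i j assume "i \<in> {..<length xs'}" "j \<in> {..<length xs'}" "i < j"
            then show "f (Suc i) - 1 < f (Suc j) - 1"
              using f(1)[of "Suc i" "Suc j"] pos[of i] xs by simp
          qed
          fix i assume "i < length xs'"
          then show "f (Suc i) - 1 < length ys" "le (xs' ! i) (ys ! (f (Suc i) - 1))"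
            using f(2)[of "Suc i"] pos[of i] xs by (auto simp: nth_Cons')
        qed
        then have "list_emb le xs' ys" by (rule Cons.IH)
        moreover have "le x y" using f(2)[of 0] True xs by simp
        ultimately show ?thesis unfolding xs by (rule list_emb_Cons2[rotated])
      next
        case False
        have pos: "0 < f i" if "i < length xs" for i
          using f(1)[of 0 i] that False xs by (cases i) auto
        have "?emb xs ys"
        proof (intro exI[of _ "\<lambda>i. f i - 1"] conjI allI impI)
          show "strict_mono_on {..<length xs} (\<lambda>i. f i - 1)"
          proof (rule strict_mono_onI)
            fix i j assume "i \<in> {..<length xs}" "j \<in> {..<length xs}" "i < j"
            then show "f i - 1 < f j - 1"
              using f(1)[of i j] pos[of i] by simp
          qed
          fix i assume "i < length xs"
          then show "f i - 1 < length ys" "le (xs ! i) (ys ! (f i - 1))"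
            using f(2)[of i] pos[of i] by (auto simp: nth_Cons')
        qed
        then have "list_emb le xs ys" by (rule Cons.IH)
        then show ?thesis by (rule list_emb_Cons)
      qed
    qed
  qed
qed

definition multisets :: "'a set \<Rightarrow> 'a multiset set" where
  "multisets Q = {M. set_mset M \<subseteq> Q}"

definition mset_emb :: "('a \<Rightarrow> 'a \<Rightarrow> bool) \<Rightarrow> 'a multiset \<Rightarrow> 'a multiset \<Rightarrow> bool" where
  "mset_emb le M N \<longleftrightarrow>
     (\<exists>xs ys. mset xs = M \<and> mset ys = N \<and>
        (\<exists>f. inj_on f {..<length xs} \<and>
             (\<forall>i<length xs. f i < length ys \<and> le (xs ! i) (ys ! f i))))"

datatype (labels: 'a) ltree = Node 'a "'a ltree list"

definition ltrees :: "'a set \<Rightarrow> 'a ltree set" where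
  "ltrees Q = {t. labels t \<subseteq> Q}"

inductive tree_emb :: "('a \<Rightarrow> 'a \<Rightarrow> bool) \<Rightarrow> 'a ltree \<Rightarrow> 'a ltree \<Rightarrow> bool"
  for le :: "'a \<Rightarrow> 'a \<Rightarrow> bool"
where
  subtree: "t' \<in> set ts' \<Longrightarrow> tree_emb le t t' \<Longrightarrow> tree_emb le t (Node x' ts')"
| root: "le x x' \<Longrightarrow> list_emb (tree_emb le) ts ts' \<Longrightarrow> tree_emb le (Node x ts) (Node x' ts')"
monos list_emb_mono

end

theory Submission
  imports Defs "HOL-Library.Ramsey"
begin

text \<open>
  Incomparable sequences are bad, so only a rank-preserving translation of bad sequences into
  incomparable ones is needed, and it can be made online.  Padding the \<open>i\<close>-th entry in a way that
  cannot create new comparabilities, but makes it larger than all earlier ones, does this for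
  sequences (\<open>\<not> b \<le> a\<close>: append \<open>a b a \<dots> a\<close>) and for trees (pair the tree with a
  long unary tree under a new root).

  For multisets the padding needs a minimal element of \<open>Q\<close>, which is then missing from the elements to
  be padded, so bad sequences have to be compared across different orders.  This is done with a
  notion of size that behaves like \<open>o(A) \<le> \<omega>\<^sup>w\<close> (\<open>piece\<close>) and \<open>o(A) \<ge> \<omega>\<^sup>w\<close>
  (\<open>large\<close>), where natural sums of exponents are multisets of weights; a set covered by finitely
  many pieces of weight \<open>w\<close> is dominated by equally many successive large blocks of weight \<open>w\<close>.
  If \<open>o(Q)\<close> is additive principal, \<open>Q\<close> is a piece of its own weight; hence the common upper bounds of
  a finite set are as large as \<open>Q\<close>.
\<close>

section \<open>Well quasi-orders of sequences and trees\<close>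

text \<open>A translation must send prefixes to prefixes, so each entry is answered knowing only the
  entries so far. The obstacle for multisets is that extra copies of the minimal element
  \<open>a\<close> can absorb elements equivalent to \<open>a\<close>. Multisets padded in this way
  must therefore avoid the class of \<open>a\<close>, and forgetting how often that class occurs
  costs a factor omega in the order type. The first entry m pays for it: multisets not above m have
  boundedly many elements among the upper bounds of m, whereas the answers use two more than that
  bound. One of the two makes up for the lost factor, the other for the finite number of pieces in a
  cover. This is also why a measure that sees only exponents of omega and ignores finite multiples
  is precise enough, and why no formula for o(M(Q)) has to be computed.\<close>

definition almost_full_on :: "('a \<Rightarrow> 'a \<Rightarrow> bool) \<Rightarrow> 'a set \<Rightarrow> bool" where
  "almost_full_on le A \<longleftrightarrow> (\<forall>f :: nat \<Rightarrow> 'a. (\<forall>i. f i \<in> A) \<longrightarrow> (\<exists>i j. i < j \<and> le (f i) (f j)))"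

lemma almost_full_onD:
  assumes "almost_full_on le A" "\<And>i. f i \<in> A"
  obtains i j :: nat where "i < j" "le (f i) (f j)"
  using assms unfolding almost_full_on_def by blast

lemma almost_full_on_subset: "almost_full_on le A \<Longrightarrow> B \<subseteq> A \<Longrightarrow> almost_full_on le B"
  unfolding almost_full_on_def by blast

lemma infinite_Ramsey_sequence:
  fixes P :: "nat \<Rightarrow> nat \<Rightarrow> bool"
  obtains \<phi> :: "nat \<Rightarrow> nat" where "strict_mono \<phi>"
    "(\<forall>i j. i < j \<longrightarrow> P (\<phi> i) (\<phi> j)) \<or> (\<forall>i j. i < j \<longrightarrow> \<not> P (\<phi> i) (\<phi> j))"
proof -
  \<comment> \<open>\<open>Ramsey2\<close> colours two-element sets; Min and Max recover the ordered
    pair.\<close>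
  define c where "c X = (if P (Min X) (Max X) then 0 else 1 :: nat)" for X
  have "\<exists>Y t. Y \<subseteq> (UNIV :: nat set) \<and> infinite Y \<and> t < 2 \<and> (\<forall>x\<in>Y. \<forall>y\<in>Y. x \<noteq> y \<longrightarrow> c {x, y} = t)"
    by (rule Ramsey2) (auto simp: c_def)
  then obtain Y :: "nat set" and t where Y: "infinite Y" and "\<forall>x\<in>Y. \<forall>y\<in>Y. x \<noteq> y \<longrightarrow> c {x, y} = t"
    by (elim exE conjE)
  then have Yt: "\<And>x y. x \<in> Y \<Longrightarrow> y \<in> Y \<Longrightarrow> x \<noteq> y \<Longrightarrow> c {x, y} = t" by simp
  let ?\<phi> = "enumerate Y"
  have mono: "strict_mono ?\<phi>" using Y by (simp add: strict_mono_enumerate)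
  have "c {?\<phi> i, ?\<phi> j} = t" if "i < j" for i j
    using Yt[of "?\<phi> i" "?\<phi> j"] enumerate_in_set[OF Y] strict_monoD[OF mono that] by simp
  moreover have "c {?\<phi> i, ?\<phi> j} = (if P (?\<phi> i) (?\<phi> j) then 0 else 1)" if "i < j" for i j
    using strict_monoD[OF mono that] by (simp add: c_def min_def max_def)
  ultimately show ?thesis
    using that[of ?\<phi>, OF mono] by (metis zero_neq_one)
qed

lemma almost_full_on_mono_subseq:
  assumes "almost_full_on le A" "\<And>i. f i \<in> A"
  obtains \<phi> :: "nat \<Rightarrow> nat" where "strict_mono \<phi>" "\<And>i j. i < j \<Longrightarrow> le (f (\<phi> i)) (f (\<phi> j))"
proof -
  obtain \<phi> :: "nat \<Rightarrow> nat" where \<phi>: "strict_mono \<phi>"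
      "(\<forall>i j. i < j \<longrightarrow> le (f (\<phi> i)) (f (\<phi> j))) \<or> (\<forall>i j. i < j \<longrightarrow> \<not> le (f (\<phi> i)) (f (\<phi> j)))"
    using infinite_Ramsey_sequence[of "\<lambda>i j. le (f i) (f j)"] by blast
  obtain i j where "i < j" "le (f (\<phi> i)) (f (\<phi> j))"
    using almost_full_onD[OF assms(1), of "f \<circ> \<phi>"] assms(2) by auto
  then show ?thesis using \<phi> that by blast
qed

text \<open>Ramsey applied to the reversed comparisons of a bad sequence leaves a subsequence that
  is strictly descending or, since the forward comparisons fail anyway, an infinite
  antichain.\<close>

lemma well_quasi_order_on_almost_full_on:
  assumes "well_quasi_order_on A le"
  shows "almost_full_on le A"
  unfolding almost_full_on_def
proof (intro allI impI, rule ccontr)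
  fix f :: "nat \<Rightarrow> 'a" assume fA: "\<forall>i. f i \<in> A" and "\<not> (\<exists>i j. i < j \<and> le (f i) (f j))"
  then have bad: "i < j \<Longrightarrow> \<not> le (f i) (f j)" for i j by blast
  obtain \<phi> :: "nat \<Rightarrow> nat" where \<phi>: "strict_mono \<phi>"
      "(\<forall>i j. i < j \<longrightarrow> le (f (\<phi> j)) (f (\<phi> i))) \<or> (\<forall>i j. i < j \<longrightarrow> \<not> le (f (\<phi> j)) (f (\<phi> i)))"
    using infinite_Ramsey_sequence[of "\<lambda>i j. le (f j) (f i)"] by blast
  have refl: "le (f i) (f i)" for i
    using assms fA by (auto simp: well_quasi_order_on_def quasi_order_on_def reflp_on_def)
  have bad\<phi>: "i < j \<Longrightarrow> \<not> le (f (\<phi> i)) (f (\<phi> j))" for i j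
    using bad \<phi>(1) by (simp add: strict_mono_def)
  from \<phi>(2) show False
  proof
    assume "\<forall>i j. i < j \<longrightarrow> le (f (\<phi> j)) (f (\<phi> i))"
    then have "\<forall>i. f (\<phi> i) \<in> A \<and> le (f (\<phi> (Suc i))) (f (\<phi> i)) \<and> \<not> le (f (\<phi> i)) (f (\<phi> (Suc i)))"
      using fA bad\<phi> by blast
    then have "\<exists>x :: nat \<Rightarrow> 'a. \<forall>i. x i \<in> A \<and> le (x (Suc i)) (x i) \<and> \<not> le (x i) (x (Suc i))"
      by (rule exI[of _ "\<lambda>i. f (\<phi> i)"])
    then show False using assms by (simp add: well_quasi_order_on_def)
  next
    assume anti: "\<forall>i j. i < j \<longrightarrow> \<not> le (f (\<phi> j)) (f (\<phi> i))"
    let ?B = "range (\<lambda>i. f (\<phi> i))"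
    have "inj (\<lambda>i. f (\<phi> i))"
      using bad\<phi> refl by (metis injI linorder_neqE_nat)
    then have "infinite ?B" by (rule range_inj_infinite)
    moreover have "\<forall>x\<in>?B. \<forall>y\<in>?B. x \<noteq> y \<longrightarrow> \<not> le x y"
      using anti bad\<phi> by (auto, metis linorder_neqE_nat)
    moreover have "?B \<subseteq> A" using fA by blast
    ultimately show False using assms unfolding well_quasi_order_on_def by blast
  qed
qed

section \<open>Minimal bad sequences, Higman's lemma and Kruskal's theorem\<close>

text \<open>Nash-Williams' construction: entry n minimises \<open>\<mu>\<close> among all bad
  sequences that share the entries before n. Whole bad sequences are carried along, since every
  finite start must remain extendable.\<close>

lemma minimal_bad_sequence:
  fixes \<mu> :: "'a \<Rightarrow> nat"
  assumes "\<not> almost_full_on le A"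
  shows "\<exists>f :: nat \<Rightarrow> 'a. (\<forall>i. f i \<in> A) \<and> (\<forall>i j. i < j \<longrightarrow> \<not> le (f i) (f j)) \<and>
    (\<forall>n g. (\<forall>i. g i \<in> A) \<longrightarrow> (\<forall>i<n. g i = f i) \<longrightarrow> \<mu> (g n) < \<mu> (f n) \<longrightarrow>
       (\<exists>i j. i < j \<and> le (g i) (g j)))"
proof -
  define bad where "bad g \<longleftrightarrow> (\<forall>i. g i \<in> A) \<and> (\<forall>i j. i < j \<longrightarrow> \<not> le (g i) (g j))" for g :: "nat \<Rightarrow> 'a"
  define P where "P n g h \<longleftrightarrow> bad h \<and> (\<forall>i<n. h i = g i) \<and> 
    (\<forall>h'. bad h' \<longrightarrow> (\<forall>i<n. h' i = g i) \<longrightarrow> \<mu> (h n) \<le> \<mu> (h' n))" for n g h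
  have ex: "\<exists>h. P n g h" if "bad g" for n g
    using ex_has_least_nat[of "\<lambda>h. bad h \<and> (\<forall>i<n. h i = g i)" g "\<lambda>h. \<mu> (h n)"] that
    unfolding P_def by blast
  obtain g0 where g0: "bad g0"
    using assms unfolding almost_full_on_def bad_def by blast
  have "\<exists>F. \<forall>n. (bad (F n) \<and> (n = 0 \<longrightarrow> P 0 g0 (F n))) \<and> P (Suc n) (F n) (F (Suc n))"
  proof (rule dependent_nat_choice[of "\<lambda>n h. bad h \<and> (n = 0 \<longrightarrow> P 0 g0 h)" "\<lambda>n g h. P (Suc n) g h"])
    show "\<exists>h. bad h \<and> ((0 :: nat) = 0 \<longrightarrow> P 0 g0 h)" using ex[OF g0, of 0] by (auto simp: P_def)
    show "\<exists>h. (bad h \<and> (Suc n = 0 \<longrightarrow> P 0 g0 h)) \<and> P (Suc n) g h" if "bad g \<and> (n = 0 \<longrightarrow> P 0 g0 g)" for g n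
      using ex[of g "Suc n"] that by (auto simp: P_def)
  qed
  then obtain F where F0: "P 0 g0 (F 0)" and FS: "\<And>n. P (Suc n) (F n) (F (Suc n))" by auto
  have bad: "bad (F n)" for n using F0 FS by (cases n) (auto simp: P_def)
  have agree: "F m i = F n i" if "i \<le> n" "n \<le> m" for i m n
    using that(2,1)
  proof (induction m rule: dec_induct)
    case (step k)
    then show ?case using FS[of k] by (auto simp: P_def)
  qed simp
  \<comment> \<open>\<open>F n\<close> is final up to index n, as later stages change only larger
    indices; the diagonal collects the final entries.\<close>
  define f where "f n = F n n" for n
  have fF: "f i = F n i" if "i \<le> n" for i n using agree[of i i n] that by (simp add: f_def)
  show ?thesis
  proof (intro exI[of _ f] conjI allI impI)
    show "f i \<in> A" for i using bad by (simp add: f_def bad_def)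
    show "\<not> le (f i) (f j)" if "i < j" for i j
      using bad[of j] fF[of i j] fF[of j j] that by (simp add: bad_def)
    fix n g assume g: "\<forall>i. g i \<in> A" "\<forall>i<n. g i = f i" "\<mu> (g n) < \<mu> (f n)"
    show "\<exists>i j. i < j \<and> le (g i) (g j)"
    proof (rule ccontr)
      assume "\<not> ?thesis"
      then have "bad g" using g(1) by (auto simp: bad_def)
      have "\<mu> (F n n) \<le> \<mu> (g n)"
      proof (cases n)
        case 0
        then show ?thesis using F0 \<open>bad g\<close> by (simp add: P_def)
      next
        case (Suc m)
        have "\<forall>i<Suc m. g i = F m i" using g(2) fF Suc by simp
        then show ?thesis using FS[of m] \<open>bad g\<close> Suc by (simp add: P_def)
      qed
      then show False using g(3) by (simp add: f_def)
    qed
  qed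
qed

text \<open>Along \<open>\<phi>\<close> the heads increase. Replacing the sequence from
  \<open>\<phi> 0\<close> on by the tails gives a shorter entry there, so by minimality two entries
  compare, and putting the heads back yields a comparison in the bad sequence.\<close>

lemma Higman:
  assumes "almost_full_on le A"
  shows "almost_full_on (list_emb le) (lists A)"
proof (rule ccontr)
  assume "\<not> ?thesis"
  then obtain f :: "nat \<Rightarrow> _" where fA: "\<And>i. f i \<in> lists A" and bad: "\<And>i j. i < j \<Longrightarrow> \<not> list_emb le (f i) (f j)"
    and min: "\<And>n g. (\<And>i. g i \<in> lists A) \<Longrightarrow> (\<And>i. i < n \<Longrightarrow> g i = f i) \<Longrightarrow> length (g n) < length (f n) \<Longrightarrow>
       \<exists>i j. i < j \<and> list_emb le (g i) (g j)"
    using minimal_bad_sequence[of "list_emb le" "lists A" length] by auto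
  have ne: "f i \<noteq> []" for i using bad[of i "Suc i"] by auto
  have hdA: "hd (f i) \<in> A" for i using fA[of i] ne[of i] by (auto simp: in_lists_conv_set)
  have tlA: "tl (f i) \<in> lists A" for i using fA[of i] by (metis list.sel(2) list.set_sel(2) in_lists_conv_set)
  obtain \<phi> :: "nat \<Rightarrow> nat" where \<phi>: "strict_mono \<phi>" "\<And>i j. i < j \<Longrightarrow> le (hd (f (\<phi> i))) (hd (f (\<phi> j)))"
    using almost_full_on_mono_subseq[OF assms, of "\<lambda>i. hd (f i)"] hdA by blast
  define g where "g i = (if i < \<phi> 0 then f i else tl (f (\<phi> (i - \<phi> 0))))" for i
  have "\<exists>i j. i < j \<and> list_emb le (g i) (g j)"
    by (rule min[of _ "\<phi> 0"]) (use fA tlA ne in \<open>auto simp: g_def\<close>)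
  then obtain i j where ij: "i < j" "list_emb le (g i) (g j)" by blast
  have emb: "list_emb le (f k) (f (\<phi> l))" if "list_emb le (f k) (tl (f (\<phi> l)))" for k l
    using list_emb_Cons[OF that, of "hd (f (\<phi> l))"] ne[of "\<phi> l"] by simp
  have mono: "\<phi> 0 \<le> \<phi> k" for k using \<phi>(1) by (simp add: strict_mono_less_eq)
  consider "j < \<phi> 0" | "i < \<phi> 0" "\<phi> 0 \<le> j" | "\<phi> 0 \<le> i" by linarith
  then show False
  proof cases
    case 1
    then show False using ij bad[of i j] by (simp add: g_def)
  next
    case 2
    then have "list_emb le (f i) (f (\<phi> (j - \<phi> 0)))" using ij emb by (simp add: g_def)
    moreover have "i < \<phi> (j - \<phi> 0)" using 2 mono[of "j - \<phi> 0"] by linarith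
    ultimately show False using bad by blast
  next
    case 3
    define k l where "k = i - \<phi> 0" and "l = j - \<phi> 0"
    have "k < l" using 3 ij by (simp add: k_def l_def)
    have "list_emb le (tl (f (\<phi> k))) (tl (f (\<phi> l)))" using 3 ij by (simp add: g_def k_def l_def)
    then have "list_emb le (hd (f (\<phi> k)) # tl (f (\<phi> k))) (hd (f (\<phi> l)) # tl (f (\<phi> l)))"
      using \<phi>(2)[OF \<open>k < l\<close>] by (intro list_emb_Cons2)
    then show False using ne bad[of "\<phi> k" "\<phi> l"] strict_monoD[OF \<phi>(1) \<open>k < l\<close>] by simp
  qed
qed

lemma size_children: "t \<in> set ts \<Longrightarrow> size t < size (Node x ts)"
  by (induction ts) auto

text \<open>The children occurring in a minimal bad sequence are themselves almost full, so Higman's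
  lemma applies to the lists of children along a subsequence with increasing root labels.\<close>

lemma Kruskal:
  assumes "almost_full_on le A"
  shows "almost_full_on (tree_emb le) (ltrees A)"
proof (rule ccontr)
  assume "\<not> ?thesis"
  then obtain f :: "nat \<Rightarrow> _" where fA: "\<And>i. f i \<in> ltrees A" and bad: "\<And>i j. i < j \<Longrightarrow> \<not> tree_emb le (f i) (f j)"
    and min: "\<And>n g. (\<And>i. g i \<in> ltrees A) \<Longrightarrow> (\<And>i. i < n \<Longrightarrow> g i = f i) \<Longrightarrow> size (g n) < size (f n) \<Longrightarrow>
       \<exists>i j. i < j \<and> tree_emb le (g i) (g j)"
    using minimal_bad_sequence[of "tree_emb le" "ltrees A" size] by auto
  have "\<exists>x ts. f i = Node x ts" for i by (cases "f i") auto
  then obtain x ts where f: "\<And>i. f i = Node (x i) (ts i)" by metis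
  have xA: "x i \<in> A" for i using fA[of i] by (simp add: f ltrees_def)
  have sA: "t \<in> ltrees A" if "t \<in> set (ts i)" for t i using fA[of i] that by (auto simp: f ltrees_def)
  have "almost_full_on (tree_emb le) (\<Union>i. set (ts i))"
  proof (rule ccontr)
    assume "\<not> ?thesis"
    then obtain g :: "nat \<Rightarrow> _" where g: "\<And>i. g i \<in> (\<Union>i. set (ts i))" and badg: "\<And>i j. i < j \<Longrightarrow> \<not> tree_emb le (g i) (g j)"
      unfolding almost_full_on_def by blast
    have "\<forall>i. \<exists>k. g i \<in> set (ts k)" using g by simp
    then obtain k where k: "\<And>i. g i \<in> set (ts (k i))" using choice[of "\<lambda>i k. g i \<in> set (ts k)"] by blast
    \<comment> \<open>Starting at a child of the earliest parent keeps all parents of the spliced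
      part at index \<open>k i0\<close> or later, which the mixed case below relies on.\<close>
    obtain i0 where i0: "\<And>i. k i0 \<le> k i"
      using ex_has_least_nat[of "\<lambda>_. True" _ k] by blast
    define h where "h i = (if i < k i0 then f i else g (i0 + (i - k i0)))" for i
    have "\<exists>i j. i < j \<and> tree_emb le (h i) (h j)"
    proof (rule min[of _ "k i0"])
      show "h i \<in> ltrees A" for i using fA k sA by (auto simp: h_def)
      show "size (h (k i0)) < size (f (k i0))" using size_children[OF k[of i0]] by (simp add: h_def f)
    qed (simp add: h_def)
    then obtain i j where ij: "i < j" "tree_emb le (h i) (h j)" by blast
    consider "j < k i0" | "i < k i0" "k i0 \<le> j" | "k i0 \<le> i" by linarith
    then show False
    proof cases
      case 1
      then show False using ij bad[of i j] by (simp add: h_def)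
    next
      case 2
      let ?l = "i0 + (j - k i0)"
      have "tree_emb le (f i) (g ?l)" using 2 ij by (simp add: h_def)
      then have "tree_emb le (f i) (f (k ?l))" using k[of ?l] by (subst (2) f) (rule tree_emb.subtree)
      moreover have "i < k ?l" using 2 i0[of ?l] by linarith
      ultimately show False using bad by blast
    next
      case 3
      then have "i0 + (i - k i0) < i0 + (j - k i0)" using ij(1) by linarith
      then show False using ij badg[of "i0 + (i - k i0)" "i0 + (j - k i0)"] 3 by (simp add: h_def)
    qed
  qed
  then have lists: "almost_full_on (list_emb (tree_emb le)) (lists (\<Union>i. set (ts i)))" by (rule Higman)
  obtain \<phi> :: "nat \<Rightarrow> nat" where \<phi>: "strict_mono \<phi>" "\<And>i j. i < j \<Longrightarrow> le (x (\<phi> i)) (x (\<phi> j))"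
    using almost_full_on_mono_subseq[OF assms, of x] xA by blast
  obtain i j where "i < j" "list_emb (tree_emb le) (ts (\<phi> i)) (ts (\<phi> j))"
    by (rule almost_full_onD[OF lists, of "\<lambda>i. ts (\<phi> i)"]) (auto simp: in_lists_conv_set)
  then have "tree_emb le (f (\<phi> i)) (f (\<phi> j))" using \<phi>(2) by (simp add: f tree_emb.root)
  then show False using bad strict_monoD[OF \<phi>(1) \<open>i < j\<close>] by blast
qed

section \<open>Ranks and padding\<close>

lemma bad_seqs_sorted_wrt:
  "bad_seqs A le = {xs. xs \<noteq> [] \<and> set xs \<subseteq> A \<and> sorted_wrt (\<lambda>x y. \<not> le x y) xs}"
  by (auto simp: bad_seqs_def sorted_wrt_iff_nth_less)

lemma incomparable_seqs_sorted_wrt: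
  "incomparable_seqs A le = {xs. xs \<noteq> [] \<and> set xs \<subseteq> A \<and> sorted_wrt (\<lambda>x y. \<not> le x y \<and> \<not> le y x) xs}"
  by (auto simp: incomparable_seqs_def sorted_wrt_iff_nth_less)

lemma incomparable_subset_bad: "incomparable_seqs A le \<subseteq> bad_seqs A le"
  by (auto simp: incomparable_seqs_def bad_seqs_def)

text \<open>The i-th sequence of a branch has more than i entries and prefixes agree, so the
  diagonal would be an infinite bad sequence.\<close>

lemma bad_seqs_no_infinite_branch:
  assumes "almost_full_on le A"
  shows "\<nexists>b :: nat \<Rightarrow> 'a list. \<forall>i. b i \<in> bad_seqs A le \<and> strict_prefix (b i) (b (Suc i))"
proof
  assume "\<exists>b. \<forall>i. b i \<in> bad_seqs A le \<and> strict_prefix (b i) (b (Suc i))"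
  then obtain b where b: "\<And>i. b i \<in> bad_seqs A le" "\<And>i. strict_prefix (b i) (b (Suc i))" by blast
  have len: "i < length (b i)" for i
  proof (induction i)
    case 0
    then show ?case using b(1)[of 0] by (simp add: bad_seqs_def)
  next
    case (Suc i)
    then show ?case using prefix_length_less[OF b(2)[of i]] by simp
  qed
  have pre: "prefix (b i) (b j)" if "i \<le> j" for i j
    using that
  proof (induction j rule: dec_induct)
    case (step k)
    then show ?case using b(2)[of k] by (meson prefix_order.trans strict_prefix_def)
  qed simp
  have nth: "b i ! i = b j ! i" if "i \<le> j" for i j
    using pre[OF that] len[of i] by (auto simp: prefix_def nth_append)
  obtain i j where ij: "i < j" "le (b i ! i) (b j ! j)"
  proof (rule almost_full_onD[OF assms, of "\<lambda>i. b i ! i"])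
    show "b i ! i \<in> A" for i using b(1)[of i] len[of i] nth_mem by (fastforce simp: bad_seqs_def)
  qed
  then have "le (b j ! i) (b j ! j)" using nth[of i j] by simp
  then show False using b(1)[of j] len[of j] ij(1) by (auto simp: bad_seqs_def)
qed

lemma ranks_into_mono:
  assumes "ranks_into T \<gamma>" "\<And>s. s \<in> S \<Longrightarrow> \<Phi> s \<in> T"
    "\<And>s t. s \<in> S \<Longrightarrow> t \<in> S \<Longrightarrow> strict_prefix s t \<Longrightarrow> strict_prefix (\<Phi> s) (\<Phi> t)"
  shows "ranks_into S \<gamma>"
proof -
  obtain f where "\<forall>s\<in>T. f s \<in> Field \<gamma>" "\<forall>s\<in>T. \<forall>t\<in>T. strict_prefix s t \<longrightarrow> (f t, f s) \<in> \<gamma> - Id"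
    using assms(1) unfolding ranks_into_def by blast
  then show ?thesis
    using assms unfolding ranks_into_def by (intro conjI exI[of _ "\<lambda>s. f (\<Phi> s)"]) auto
qed

lemma ord_width_eq_max_order_typeI:
  assumes af: "almost_full_on le A"
    and \<Phi>: "\<And>s. s \<in> bad_seqs A le \<Longrightarrow> \<Phi> s \<in> incomparable_seqs A le"
      "\<And>s t. s \<in> bad_seqs A le \<Longrightarrow> t \<in> bad_seqs A le \<Longrightarrow> strict_prefix s t \<Longrightarrow> strict_prefix (\<Phi> s) (\<Phi> t)"
  shows "ord_width A le =o max_order_type A le"
proof -
  note bad = bad_seqs_no_infinite_branch[OF af]
  then have inc: "\<nexists>b :: nat \<Rightarrow> 'a list. \<forall>i. b i \<in> incomparable_seqs A le \<and> strict_prefix (b i) (b (Suc i))"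
    using incomparable_subset_bad[of A le] by blast
  have "ranks_into (incomparable_seqs A le) (max_order_type A le)"
    unfolding max_order_type_def using incomparable_subset_bad[of A le]
    by (intro ranks_into_mono[OF tree_rank_least(1)[OF bad], of _ "\<lambda>s. s"]) auto
  then have le: "ord_width A le \<le>o max_order_type A le"
    unfolding ord_width_def by (rule tree_rank_least(2)[OF inc])
  have "ranks_into (bad_seqs A le) (ord_width A le)"
    unfolding ord_width_def by (rule ranks_into_mono[OF tree_rank_least(1)[OF inc] \<Phi>])
  then have ge: "max_order_type A le \<le>o ord_width A le"
    unfolding max_order_type_def by (rule tree_rank_least(2)[OF bad])
  show ?thesis using le ge by (simp add: ordIso_iff_ordLeq)
qed

text \<open>The amount k exceeds the previous amount and the size of the entry just emitted. It
  depends only on earlier entries, so prefixes go to prefixes.\<close>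

fun pad :: "(nat \<Rightarrow> 'c \<Rightarrow> 'a) \<Rightarrow> ('a \<Rightarrow> nat) \<Rightarrow> nat \<Rightarrow> 'c list \<Rightarrow> 'a list" where
  "pad f \<mu> k [] = []"
| "pad f \<mu> k (c # s) = f k c # pad f \<mu> (Suc (max k (\<mu> (f k c)))) s"

lemma length_pad [simp]: "length (pad f \<mu> k s) = length s"
  by (induction f \<mu> k s rule: pad.induct) auto

lemma prefix_pad: "prefix s t \<Longrightarrow> prefix (pad f \<mu> k s) (pad f \<mu> k t)"
proof (induction s arbitrary: k t)
  case (Cons c s)
  then show ?case by (cases t) auto
qed simp

lemma set_pad: "y \<in> set (pad f \<mu> k s) \<Longrightarrow> \<exists>i\<ge>k. \<exists>c\<in>set s. y = f i c"
proof (induction f \<mu> k s rule: pad.induct)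
  case (2 f \<mu> k c s)
  then show ?case by (auto, metis Suc_leD max.bounded_iff)
qed simp

text \<open>
  The padding makes later entries strictly larger in size, so they cannot lie below earlier ones;
  the bad sequence itself keeps them from lying above.
\<close>

lemma pad_incomparable:
  assumes reflect: "\<And>i j c d. c \<in> C \<Longrightarrow> d \<in> C \<Longrightarrow> le (f i c) (f j d) \<Longrightarrow> leC c d"
    and size: "\<And>x y. le x y \<Longrightarrow> \<mu> x \<le> \<mu> y" "\<And>k c. k \<le> \<mu> (f k c)"
    and s: "set s \<subseteq> C" "sorted_wrt (\<lambda>x y. \<not> leC x y) s"
  shows "sorted_wrt (\<lambda>x y. \<not> le x y \<and> \<not> le y x) (pad f \<mu> k s)"
  using s
proof (induction s arbitrary: k)
  case (Cons c s)
  let ?k = "Suc (max k (\<mu> (f k c)))"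
  have "\<not> le (f k c) y \<and> \<not> le y (f k c)" if y: "y \<in> set (pad f \<mu> ?k s)" for y
  proof -
    obtain i d where id: "?k \<le> i" "d \<in> set s" "y = f i d" using set_pad[OF y] by blast
    have "\<mu> (f k c) < \<mu> y" using id size(2)[of i d] by simp
    then have "\<not> le y (f k c)" using size(1) leD by blast
    moreover have "\<not> le (f k c) y" using Cons.prems id reflect[of c d k i] by auto
    ultimately show ?thesis by simp
  qed
  then show ?case using Cons by simp
qed simp

lemma ord_width_eq_max_order_type_pad:
  fixes f :: "nat \<Rightarrow> 'a \<Rightarrow> 'a"
  assumes af: "almost_full_on le A"
    and f: "\<And>k x. x \<in> A \<Longrightarrow> f k x \<in> A"
    and reflect: "\<And>i j c d. c \<in> A \<Longrightarrow> d \<in> A \<Longrightarrow> le (f i c) (f j d) \<Longrightarrow> le c d"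
    and size: "\<And>x y. le x y \<Longrightarrow> \<mu> x \<le> \<mu> y" "\<And>k c. k \<le> \<mu> (f k c)"
  shows "ord_width A le =o max_order_type A le"
proof (rule ord_width_eq_max_order_typeI[OF af, of "pad f \<mu> 0"])
  fix s assume "s \<in> bad_seqs A le"
  then have s: "s \<noteq> []" "set s \<subseteq> A" "sorted_wrt (\<lambda>x y. \<not> le x y) s"
    by (auto simp: bad_seqs_sorted_wrt)
  have "set (pad f \<mu> 0 s) \<subseteq> A" using set_pad f s(2) by fastforce
  moreover have "pad f \<mu> 0 s \<noteq> []" using s(1) by (cases s) auto
  ultimately show "pad f \<mu> 0 s \<in> incomparable_seqs A le"
    using pad_incomparable[of A le f le \<mu> s 0] reflect size s by (simp add: incomparable_seqs_sorted_wrt)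
next
  fix s t :: "'a list" assume "strict_prefix s t"
  then have "prefix (pad f \<mu> 0 s) (pad f \<mu> 0 t)" "length (pad f \<mu> 0 s) < length (pad f \<mu> 0 t)"
    using prefix_pad[of s t] prefix_length_less[of s t] by (auto simp: strict_prefix_def)
  then show "strict_prefix (pad f \<mu> 0 s) (pad f \<mu> 0 t)"
    by (metis less_irrefl strict_prefix_def)
qed

section \<open>The width of finite sequences\<close>

text \<open>If \<open>xs\<close> does not fit into \<open>ys\<close>, its image consumes at least
  one entry of \<open>vs\<close>, so only the tail is left for \<open>us\<close>.\<close>

lemma list_emb_append_cases:
  assumes "list_emb le (xs @ us) (ys @ vs)"
  shows "list_emb le xs ys \<or> list_emb le us (tl vs)"
proof -
  obtain as bs where asbs: "ys @ vs = as @ bs" "list_emb le xs as" "list_emb le us bs"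
    using list_emb_appendD[OF assms] by blast
  then consider zs where "ys = as @ zs" | z zs where "as = ys @ z # zs" "vs = (z # zs) @ bs"
    by (auto simp: append_eq_append_conv2) (metis append_Nil2 neq_Nil_conv)
  then show ?thesis
  proof cases
    case 1
    then show ?thesis using asbs(2) list_emb_append2 by (metis list_emb_prefix)
  next
    case 2
    then show ?thesis using asbs(3) list_emb_append2[of le us bs zs] by simp
  qed
qed

lemma list_emb_tl: "list_emb le (x # xs) ys \<Longrightarrow> list_emb le xs ys"
  by (induction ys) (auto elim: list_emb.cases)

lemma ord_width_lists:
  assumes af: "almost_full_on le Q" and ab: "a \<in> Q" "b \<in> Q" "\<not> le b a"
  shows "ord_width (lists Q) (list_emb le) =o max_order_type (lists Q) (list_emb le)"
proof (rule ord_width_eq_max_order_type_pad[where f = "\<lambda>k xs. xs @ a # b # replicate k a" and \<mu> = length])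
  show "almost_full_on (list_emb le) (lists Q)" using af by (rule Higman)
  show "xs @ a # b # replicate k a \<in> lists Q" if "xs \<in> lists Q" for k xs
    using that ab by (auto simp: in_lists_conv_set)
  show "list_emb le xs ys \<Longrightarrow> length xs \<le> length ys" for xs ys by (rule list_emb_length)
  show "k \<le> length (xs @ a # b # replicate k a)" for k and xs :: "'a list" by simp
  fix i j xs ys assume "list_emb le (xs @ a # b # replicate i a) (ys @ a # b # replicate j a)"
  \<comment> \<open>In the second alternative the leading \<open>a\<close> consumes at least one
    entry, leaving \<open>b\<close> to embed into copies of \<open>a\<close>.\<close>
  then have "list_emb le xs ys \<or> list_emb le (a # b # replicate i a) (b # replicate j a)"
    using list_emb_append_cases by fastforce
  moreover have "\<not> list_emb le (b # us) (replicate n a)" for us n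
    by (induction n) (use ab in auto)
  then have "\<not> list_emb le (a # b # replicate i a) (b # replicate j a)"
    by (auto elim: list_emb.cases dest: list_emb_tl)
  ultimately show "list_emb le xs ys" by blast
qed

section \<open>The width of trees\<close>

lemma tree_emb_child:
  assumes "tree_emb le (Node x ts) s" "t \<in> set ts"
  shows "tree_emb le t s"
  using assms
proof (induction s rule: ltree.induct)
  case (Node y ss)
  from Node.prems(1) show ?case
  proof cases
    case (subtree s')
    then show ?thesis using Node by (blast intro: tree_emb.subtree)
  next
    case root
    then obtain s' where "s' \<in> set ss" "tree_emb le t s'"
      using list_emb_set Node.prems(2) by metis
    then show ?thesis by (rule tree_emb.subtree)
  qed
qed

lemma list_emb_sum_list:
  assumes "list_emb P xs ys" "\<And>x y. x \<in> set xs \<Longrightarrow> y \<in> set ys \<Longrightarrow> P x y \<Longrightarrow> g x \<le> (g y :: nat)"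
  shows "(\<Sum>x\<leftarrow>xs. g x) \<le> (\<Sum>y\<leftarrow>ys. g y)"
  using assms
proof (induction rule: list_emb.induct)
  case (list_emb_Cons xs ys y)
  then have "(\<Sum>x\<leftarrow>xs. g x) \<le> (\<Sum>y\<leftarrow>ys. g y)" by simp
  then show ?case by simp
next
  case (list_emb_Cons2 x y xs ys)
  then have "(\<Sum>x\<leftarrow>xs. g x) \<le> (\<Sum>y\<leftarrow>ys. g y)" "g x \<le> g y" by simp_all
  then show ?case by simp
qed simp

fun nodes :: "'a ltree \<Rightarrow> nat" where
  "nodes (Node x ts) = Suc (\<Sum>t\<leftarrow>ts. nodes t)"

lemma tree_emb_nodes: "tree_emb le s t \<Longrightarrow> nodes s \<le> nodes t"
proof (induction t arbitrary: s)
  case (Node y ts)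
  from Node.prems show ?case
  proof cases
    case (subtree t')
    then have "nodes s \<le> nodes t'" using Node.IH by blast
    also have "\<dots> \<le> (\<Sum>t\<leftarrow>ts. nodes t)" using subtree by (simp add: member_le_sum_list)
    finally show ?thesis by simp
  next
    case (root x ss)
    then have "(\<Sum>x\<leftarrow>ss. nodes x) \<le> (\<Sum>y\<leftarrow>ts. nodes y)"
      using list_emb_sum_list[of "tree_emb le" ss ts nodes] Node.IH by simp
    then show ?thesis using root by simp
  qed
qed

fun chain :: "'a \<Rightarrow> nat \<Rightarrow> 'a ltree" where
  "chain a 0 = Node a []"
| "chain a (Suc n) = Node a [chain a n]"

text \<open>Branching marks the padded trees: matching roots needs room for two children, and a
  vertex of a chain has at most one.\<close>

lemma not_tree_emb_chain: "\<not> tree_emb le (Node x [s, t]) (chain a n)"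
proof (induction n)
  case 0
  show ?case by (auto elim: tree_emb.cases)
next
  case (Suc n)
  show ?case
  proof
    assume "tree_emb le (Node x [s, t]) (chain a (Suc n))"
    then show False using Suc by cases (auto dest: list_emb_length)
  qed
qed

lemma ord_width_ltrees:
  assumes af: "almost_full_on le Q"
  shows "ord_width (ltrees Q) (tree_emb le) =o max_order_type (ltrees Q) (tree_emb le)"
\<comment> \<open>An empty \<open>Q\<close> offers no label for the pad, but then there are no trees
  at all.\<close>
proof (cases "Q = {}")
  case True
  have "labels t \<noteq> {}" for t :: "'a ltree" by (cases t) auto
  then have "ltrees Q = {}" using True by (auto simp: ltrees_def)
  then have "almost_full_on (tree_emb le) (ltrees Q)" "bad_seqs (ltrees Q) (tree_emb le) = {}"
    by (auto simp: almost_full_on_def bad_seqs_def)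
  then show ?thesis by (intro ord_width_eq_max_order_typeI[of _ _ "\<lambda>s. s"]) auto
next
  case False
  then obtain a where a: "a \<in> Q" by blast
  have chain: "labels (chain a n) = {a}" for n by (induction n) auto
  have nodes: "nodes (chain a n) = Suc n" for n by (induction n) auto
  show ?thesis
  proof (rule ord_width_eq_max_order_type_pad[where f = "\<lambda>k t. Node a [t, chain a k]" and \<mu> = nodes])
    show "almost_full_on (tree_emb le) (ltrees Q)" using af by (rule Kruskal)
    show "Node a [t, chain a k] \<in> ltrees Q" if "t \<in> ltrees Q" for k t
      using that a by (simp add: ltrees_def chain)
    show "tree_emb le s t \<Longrightarrow> nodes s \<le> nodes t" for s t by (rule tree_emb_nodes)
    show "k \<le> nodes (Node a [t, chain a k])" for k t by (simp add: nodes)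
    fix i j s t assume "tree_emb le (Node a [s, chain a i]) (Node a [t, chain a j])"
    then show "tree_emb le s t"
    proof cases
      \<comment> \<open>The chain cannot host the branching root, so the padded tree lies below
        \<open>t\<close>, and with it its child \<open>s\<close>.\<close>
      case (subtree t')
      then have "tree_emb le (Node a [s, chain a i]) t" using not_tree_emb_chain by fastforce
      then show ?thesis by (rule tree_emb_child) simp
    next
      case root
      from root(2) show ?thesis by (rule list_emb.cases) (auto dest: list_emb_length)
    qed
  qed
qed

section \<open>Pieces and large sets\<close>

text \<open>The moves left to a bad sequence after \<open>a\<close>. The order type of A is the
  least ordinal exceeding the order types of all its residuals; \<open>piece\<close> and
  \<open>dominated\<close> rest on this recursion.\<close>

definition residual :: "('a \<Rightarrow> 'a \<Rightarrow> bool) \<Rightarrow> 'a set \<Rightarrow> 'a \<Rightarrow> 'a set" where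
  "residual le A a = {x \<in> A. \<not> le a x}"

text \<open>A bad sequence may exhaust Y and then still use all of X, so o(X) + o(Y) is a lower
  bound for the type of the union.\<close>

definition precedes :: "('a \<Rightarrow> 'a \<Rightarrow> bool) \<Rightarrow> 'a set \<Rightarrow> 'a set \<Rightarrow> bool" where
  "precedes le X Y \<longleftrightarrow> (\<forall>x\<in>X. \<forall>y\<in>Y. \<not> le y x)"

text \<open>Reads o(A) \<le> omega^w: every residual has type below omega^w, hence bounded by a
  finite sum of powers omega^v with v below w. Covers express this because the type of a finite
  union is at most the natural sum of the types.\<close>

inductive piece :: "('a \<Rightarrow> 'a \<Rightarrow> bool) \<Rightarrow> 'w rel \<Rightarrow> 'w \<Rightarrow> 'a set \<Rightarrow> bool"
  for le :: "'a \<Rightarrow> 'a \<Rightarrow> bool" and R :: "'w rel"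
where
  pieceI: "(\<And>a. a \<in> A \<Longrightarrow> \<exists>C. finite C \<and> residual le A a \<subseteq> \<Union>C \<and>
    (\<forall>B\<in>C. \<exists>v. (v, w) \<in> R \<and> piece le R v B)) \<Longrightarrow> piece le R w A"

text \<open>\<open>small\<close> reads o(A) < omega^w, and \<open>covered\<close> below reads o(A)
  \<le> omega^w n for some finite n.\<close>

definition small :: "('a \<Rightarrow> 'a \<Rightarrow> bool) \<Rightarrow> 'w rel \<Rightarrow> 'w \<Rightarrow> 'a set \<Rightarrow> bool" where
  "small le R w A \<longleftrightarrow> (\<exists>C. finite C \<and> A \<subseteq> \<Union>C \<and> (\<forall>B\<in>C. \<exists>v. (v, w) \<in> R \<and> piece le R v B))"

definition covered :: "('a \<Rightarrow> 'a \<Rightarrow> bool) \<Rightarrow> 'w rel \<Rightarrow> 'w \<Rightarrow> 'a set \<Rightarrow> bool" where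
  "covered le R w A \<longleftrightarrow> (\<exists>C. finite C \<and> A \<subseteq> \<Union>C \<and> (\<forall>B\<in>C. piece le R w B))"

text \<open>Reads o(A) \<ge> omega^w, since omega^w is the supremum of omega^v n over v below w and
  finite n; for w = 0 only a point is asked for.\<close>

inductive large :: "('a \<Rightarrow> 'a \<Rightarrow> bool) \<Rightarrow> 'w rel \<Rightarrow> 'w \<Rightarrow> 'a set \<Rightarrow> bool"
  for le :: "'a \<Rightarrow> 'a \<Rightarrow> bool" and R :: "'w rel"
where
  largeI: "A \<noteq> {} \<Longrightarrow> (\<And>v. (v, w) \<in> R \<Longrightarrow> \<exists>Bs :: nat \<Rightarrow> 'a set.
    (\<forall>i. Bs i \<subseteq> A \<and> large le R v (Bs i)) \<and> (\<forall>i j. i < j \<longrightarrow> precedes le (Bs i) (Bs j))) \<Longrightarrow> large le R w A"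

lemma piece_iff_small: "piece le R w A \<longleftrightarrow> (\<forall>a\<in>A. small le R w (residual le A a))"
proof
  assume "piece le R w A"
  then show "\<forall>a\<in>A. small le R w (residual le A a)"
    by cases (simp add: small_def)
qed (auto simp: small_def intro!: pieceI)

lemma small_subset: "small le R w B \<Longrightarrow> A \<subseteq> B \<Longrightarrow> small le R w A"
  unfolding small_def by (meson order.trans)

lemma small_Un:
  assumes "small le R w A" "small le R w B"
  shows "small le R w (A \<union> B)"
proof -
  obtain C D where "finite C \<and> A \<subseteq> \<Union>C \<and> (\<forall>X\<in>C. \<exists>v. (v, w) \<in> R \<and> piece le R v X)"
      "finite D \<and> B \<subseteq> \<Union>D \<and> (\<forall>X\<in>D. \<exists>v. (v, w) \<in> R \<and> piece le R v X)"
    using assms unfolding small_def by blast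
  then show ?thesis
    unfolding small_def by (intro exI[of _ "C \<union> D"]) auto
qed

lemma small_empty: "small le R w {}"
  unfolding small_def by (intro exI[of _ "{}"]) auto

lemma small_UN: "finite I \<Longrightarrow> (\<And>i. i \<in> I \<Longrightarrow> small le R w (F i)) \<Longrightarrow> small le R w (\<Union>i\<in>I. F i)"
  by (induction I rule: finite_induct) (auto simp: small_empty small_Un)

lemma small_piece: "(v, w) \<in> R \<Longrightarrow> piece le R v A \<Longrightarrow> small le R w A"
  unfolding small_def by (intro exI[of _ "{A}"]) auto

lemma covered_Un:
  assumes "covered le R w A" "covered le R w B"
  shows "covered le R w (A \<union> B)"
proof -
  obtain C D where "finite C \<and> A \<subseteq> \<Union>C \<and> (\<forall>X\<in>C. piece le R w X)"
      "finite D \<and> B \<subseteq> \<Union>D \<and> (\<forall>X\<in>D. piece le R w X)"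
    using assms unfolding covered_def by blast
  then show ?thesis
    unfolding covered_def by (intro exI[of _ "C \<union> D"]) auto
qed

lemma covered_subset: "covered le R w B \<Longrightarrow> A \<subseteq> B \<Longrightarrow> covered le R w A"
  unfolding covered_def by (meson order.trans)

lemma covered_piece: "piece le R w A \<Longrightarrow> covered le R w A"
  unfolding covered_def by (intro exI[of _ "{A}"]) auto

lemma covered_imp_small: "covered le R v A \<Longrightarrow> (v, w) \<in> R \<Longrightarrow> small le R w A"
  unfolding covered_def small_def by blast

text \<open>A map that reflects the order sends bad sequences to bad sequences, so its domain is no
  larger than its target.\<close>

lemma piece_reflect:
  assumes "piece le R w A" "f ` C \<subseteq> A"
    and reflect: "\<And>c d. c \<in> C \<Longrightarrow> d \<in> C \<Longrightarrow> le (f c) (f d) \<Longrightarrow> le' c d"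
  shows "piece le' R w C"
proof -
  \<comment> \<open>Preimages keep the induction going: the members of a cover of a residual need
    not contain the image of C.\<close>
  have "piece le' R w {c \<in> C. f c \<in> A}"
    using assms(1)
  proof (induction rule: piece.induct)
    case (pieceI A w)
    show ?case
    proof (rule piece.pieceI)
      fix c assume "c \<in> {c \<in> C. f c \<in> A}"
      then have c: "c \<in> C" "f c \<in> A" by auto
      from pieceI.IH[OF c(2)] obtain D where D: "finite D" "residual le A (f c) \<subseteq> \<Union>D"
          "\<forall>B\<in>D. \<exists>v. (v, w) \<in> R \<and> piece le R v B \<and> piece le' R v {c \<in> C. f c \<in> B}"
        by (elim exE conjE)
      let ?D = "(\<lambda>B. {d \<in> C. f d \<in> B}) ` D"
      have "residual le' {c \<in> C. f c \<in> A} c \<subseteq> \<Union>?D"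
      proof
        fix d assume "d \<in> residual le' {c \<in> C. f c \<in> A} c"
        then have d: "d \<in> C" "f d \<in> A" "\<not> le (f c) (f d)" using reflect c by (auto simp: residual_def)
        then have "f d \<in> residual le A (f c)" by (auto simp: residual_def)
        then show "d \<in> \<Union>?D" using D(2) d(1) by auto
      qed
      then show "\<exists>D. finite D \<and> residual le' {c \<in> C. f c \<in> A} c \<subseteq> \<Union>D \<and>
          (\<forall>B\<in>D. \<exists>v. (v, w) \<in> R \<and> piece le' R v B)"
        using D(1,3) by (intro exI[of _ ?D]) auto
    qed
  qed
  moreover have "{c \<in> C. f c \<in> A} = C" using assms(2) by blast
  ultimately show ?thesis by simp
qed

lemma piece_subset: "piece le R w A \<Longrightarrow> C \<subseteq> A \<Longrightarrow> piece le R w C"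
  by (rule piece_reflect[where f = "\<lambda>x. x" and le = le]) auto

lemma piece_weight:
  assumes "piece le R w A" "\<And>v w. (v, w) \<in> R \<Longrightarrow> (\<phi> v, \<phi> w) \<in> S"
  shows "piece le S (\<phi> w) A"
  using assms(1)
proof (induction rule: piece.induct)
  case (pieceI A w)
  show ?case
    by (rule piece.pieceI) (use pieceI.IH assms(2) in meson)
qed

lemma small_trans:
  assumes "trans R" "(v, w) \<in> R" "small le R v A"
  shows "small le R w A"
proof -
  obtain C where "finite C" "A \<subseteq> \<Union>C" "\<forall>B\<in>C. \<exists>u. (u, v) \<in> R \<and> piece le R u B"
    using assms(3) unfolding small_def by (elim exE conjE)
  then show ?thesis
    unfolding small_def using transD[OF assms(1) _ assms(2)] by (intro exI[of _ C]) blast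
qed

lemma piece_trans: "trans R \<Longrightarrow> (v, w) \<in> R \<Longrightarrow> piece le R v A \<Longrightarrow> piece le R w A"
  using small_trans[of R v w le] by (simp add: piece_iff_small)

lemma large_nonempty: "large le R w A \<Longrightarrow> A \<noteq> {}"
  by (erule large.cases) simp

lemma largeD:
  fixes le :: "'a \<Rightarrow> 'a \<Rightarrow> bool"
  assumes "large le R w A" "(v, w) \<in> R"
  obtains Bs :: "nat \<Rightarrow> 'a set" where "\<And>i. Bs i \<subseteq> A" "\<And>i. large le R v (Bs i)"
    "\<And>i j. i < j \<Longrightarrow> precedes le (Bs i) (Bs j)"
  using assms(1)
proof cases
  case largeI
  then show ?thesis using assms(2) that by meson
qed

lemma large_reflect:
  assumes "large le R w A" "g ` A \<subseteq> B"
    and reflect: "\<And>a b. a \<in> A \<Longrightarrow> b \<in> A \<Longrightarrow> le' (g a) (g b) \<Longrightarrow> le a b"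
  shows "large le' R w B"
proof -
  have "C \<subseteq> A \<longrightarrow> (\<forall>D. g ` C \<subseteq> D \<longrightarrow> large le' R w D)" if "large le R w C" for C
    using that
  proof (induction rule: large.induct)
    case (largeI C w)
    show ?case
    proof (intro impI allI, rule large.largeI)
      fix D assume C: "C \<subseteq> A" and D: "g ` C \<subseteq> D"
      show "D \<noteq> {}" using largeI.hyps D by auto
      fix v assume "(v, w) \<in> R"
      from largeI.IH[OF this] obtain Bs :: "nat \<Rightarrow> _" where Bs: "\<forall>i. Bs i \<subseteq> C \<and> (large le R v (Bs i) \<and>
            (Bs i \<subseteq> A \<longrightarrow> (\<forall>D. g ` Bs i \<subseteq> D \<longrightarrow> large le' R v D)))"
          "\<forall>i j. i < j \<longrightarrow> precedes le (Bs i) (Bs j)"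
        by (elim exE conjE)
      have sub: "Bs i \<subseteq> A" for i using Bs(1) C by blast
      have "g ` Bs i \<subseteq> D \<and> large le' R v (g ` Bs i)" for i
        using Bs(1) sub[of i] D by blast
      moreover have "precedes le' (g ` Bs i) (g ` Bs j)" if "i < j" for i j
        unfolding precedes_def
      proof clarify
        fix x y assume "x \<in> Bs i" "y \<in> Bs j" "le' (g y) (g x)"
        then have "le y x" using reflect[of y x] sub[of i] sub[of j] by blast
        then show False using Bs(2) that \<open>x \<in> Bs i\<close> \<open>y \<in> Bs j\<close> unfolding precedes_def by blast
      qed
      ultimately show "\<exists>Bs :: nat \<Rightarrow> _. (\<forall>i. Bs i \<subseteq> D \<and> large le' R v (Bs i)) \<and>
          (\<forall>i j. i < j \<longrightarrow> precedes le' (Bs i) (Bs j))"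
        by (intro exI[of _ "\<lambda>i. g ` Bs i"]) simp
    qed
  qed
  then show ?thesis using assms(1,2) by blast
qed

lemma large_trans:
  fixes le :: "'a \<Rightarrow> 'a \<Rightarrow> bool"
  assumes "trans R" "(v, w) \<in> R" "large le R w A"
  shows "large le R v A"
proof (rule largeI)
  show "A \<noteq> {}" using assms(3) by (rule large_nonempty)
  fix u assume "(u, v) \<in> R"
  then have "(u, w) \<in> R" using assms by (meson transD)
  then show "\<exists>Bs :: nat \<Rightarrow> 'a set. (\<forall>i. Bs i \<subseteq> A \<and> large le R u (Bs i)) \<and> (\<forall>i j. i < j \<longrightarrow> precedes le (Bs i) (Bs j))"
    using largeD[OF assms(3)] by metis
qed

text \<open>A descending chain of residuals spells out an infinite bad sequence.\<close>

lemma wf_residual: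
  assumes "almost_full_on le X"
  shows "wf {(residual le B b, B) | B b. B \<subseteq> X \<and> b \<in> B}"
  unfolding wf_iff_no_infinite_down_chain
proof
  assume "\<exists>F. \<forall>i. (F (Suc i), F i) \<in> {(residual le B b, B) | B b. B \<subseteq> X \<and> b \<in> B}"
  then obtain F where "\<forall>i. \<exists>b. F (Suc i) = residual le (F i) b \<and> F i \<subseteq> X \<and> b \<in> F i" by auto
  then obtain b where b: "\<And>i. F (Suc i) = residual le (F i) (b i)" "\<And>i. F i \<subseteq> X" "\<And>i. b i \<in> F i"
    by metis
  have decr: "F j \<subseteq> F i" if "i \<le> j" for i j
    using that by (induction j rule: dec_induct) (auto simp: b(1) residual_def)
  have "b i \<in> X" for i using b(2,3) by blast
  then obtain i j where "i < j" "le (b i) (b j)" using almost_full_onD[OF assms, of b] by metis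
  moreover have "b j \<in> F (Suc i)" using b(3)[of j] decr[of "Suc i" j] \<open>i < j\<close> by auto
  ultimately show False by (simp add: b(1) residual_def)
qed

text \<open>The sets themselves serve as weights: in a well-order extending the residual relation, B
  is a piece of weight B because each residual is a single piece of smaller weight. The bound is
  crude; \<open>exists_least_weight\<close> improves it.\<close>

lemma exists_weights:
  fixes X :: "'a set"
  assumes "almost_full_on le X"
  obtains R :: "'a set rel" where "wf R" "trans R" "total R" "\<And>B. B \<subseteq> X \<Longrightarrow> piece le R B B"
proof -
  let ?E = "{(residual le B b, B) | B b. B \<subseteq> X \<and> b \<in> B}"
  obtain W :: "'a set rel" where W: "Well_order W" "Field W = UNIV" "?E \<subseteq> W - Id"
    using wf_extends_to_Well_order[OF wf_residual[OF assms]] by (elim exE conjE)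
  have ord: "wf (W - Id)" "trans W" "antisym W" "total W"
    using W by (auto simp: well_order_on_def linear_order_on_def partial_order_on_def preorder_on_def)
  have "piece le (W - Id) B B" if "B \<subseteq> X" for B
    using ord(1) that
  proof (induction B rule: wf_induct_rule)
    case (less B)
    have "small le (W - Id) B (residual le B b)" if b: "b \<in> B" for b
    proof (rule small_piece)
      show "(residual le B b, B) \<in> W - Id" using W(3) less.prems b by blast
      then show "piece le (W - Id) (residual le B b) (residual le B b)"
        by (rule less.IH) (use less.prems in \<open>auto simp: residual_def\<close>)
    qed
    then show ?case by (simp add: piece_iff_small)
  qed
  moreover have "trans (W - Id)"
    using ord(2,3) by (rule trans_diff_Id)
  moreover have "total (W - Id)" using ord(4) by simp
  ultimately show ?thesis using that ord(1) by blast
qed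

text \<open>A final segment that is no piece has a residual that is not small; the element defining
  this residual is the next rung.\<close>

lemma exists_ladder:
  fixes le :: "'a \<Rightarrow> 'a \<Rightarrow> bool"
  assumes "A \<noteq> {}" "\<And>t. t \<in> A \<Longrightarrow> \<not> piece le R v {x \<in> A. le t x}"
  shows "\<exists>t :: nat \<Rightarrow> 'a. \<forall>i. t i \<in> A \<and>
    (le (t i) (t (Suc i)) \<and> \<not> small le R v {x \<in> A. le (t i) x \<and> \<not> le (t (Suc i)) x})"
proof (rule dependent_nat_choice)
    show "\<exists>t. t \<in> A" using assms(1) by blast
    fix t assume "t \<in> A"
    from assms(2)[OF this] obtain u where u: "u \<in> A" "le t u" "\<not> small le R v (residual le {x \<in> A. le t x} u)"
      by (auto simp: piece_iff_small)
    moreover have "residual le {x \<in> A. le t x} u = {x \<in> A. le t x \<and> \<not> le u x}"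
      by (auto simp: residual_def)
    ultimately show "\<exists>u. u \<in> A \<and> (le t u \<and> \<not> small le R v {x \<in> A. le t x \<and> \<not> le u x})" by auto
qed

lemma ladder_le:
  fixes t :: "nat \<Rightarrow> 'a"
  assumes "transp_on A le" "\<And>i. t i \<in> A" "\<And>i. le (t i) (t (Suc i))" "i \<le> j" "y \<in> A" "le (t j) y"
  shows "le (t i) y"
  using assms(4,6)
proof (induction j rule: dec_induct)
  case (step k)
  then show ?case using assms(1-3,5) by (meson transp_onD)
qed

lemma ladder_precedes:
  fixes t :: "nat \<Rightarrow> 'a"
  assumes tr: "transp_on A le" and t: "\<And>i. t i \<in> A" "\<And>i. le (t i) (t (Suc i))" and "i < j"
  shows "precedes le {x \<in> A. le (t i) x \<and> \<not> le (t (Suc i)) x} {x \<in> A. le (t j) x \<and> \<not> le (t (Suc j)) x}"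
  unfolding precedes_def
proof (clarify)
  fix x y assume x: "x \<in> A" "\<not> le (t (Suc i)) x" and y: "y \<in> A" "le (t j) y" and "le y x"
  have "le (t (Suc i)) y" using ladder_le[of A le t "Suc i" j y, OF tr t] y \<open>i < j\<close> by simp
  then have "le (t (Suc i)) x" using \<open>le y x\<close> x y t tr by (meson transp_onD)
  then show False using x by simp
qed

text \<open>
  Shrink \<open>A\<close> until all its residuals are covered by pieces of weight \<open>v\<close>; then every final segment
  of \<open>A\<close> stays big, and the layers between the elements of a ladder in \<open>A\<close> are the blocks.
\<close>

lemma not_small_imp_large:
  fixes le :: "'a \<Rightarrow> 'a \<Rightarrow> bool"
  assumes "wf R" and af: "almost_full_on le X" and tr: "transp_on X le"
  shows "A \<subseteq> X \<Longrightarrow> \<not> small le R w A \<Longrightarrow> large le R w A"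
  using assms(1)
proof (induction w arbitrary: A rule: wf_induct_rule)
  case (less w)
  show ?case
  proof (rule largeI)
    show "A \<noteq> {}" using less.prems(2) small_empty[of le R w] by (cases "A = {}") auto
    fix v assume v: "(v, w) \<in> R"
    have "\<exists>A'\<subseteq>B. \<not> covered le R v A' \<and> (\<forall>a\<in>A'. covered le R v (residual le A' a))"
      if "B \<subseteq> X" "\<not> covered le R v B" for B
      using wf_residual[OF af] that
    proof (induction B rule: wf_induct_rule)
      case (less B)
      show ?case
      proof (cases "\<forall>a\<in>B. covered le R v (residual le B a)")
        case False
        then obtain b where b: "b \<in> B" "\<not> covered le R v (residual le B b)" by blast
        moreover have sub: "residual le B b \<subseteq> B" by (auto simp: residual_def)
        moreover have "(residual le B b, B) \<in> {(residual le B b, B) | B b. B \<subseteq> X \<and> b \<in> B}"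
          using less.prems b by blast
        ultimately show ?thesis
          using less.IH[of "residual le B b"] less.prems by (meson order.trans)
      qed (use less in blast)
    qed
    moreover have "\<not> covered le R v A" using covered_imp_small[of le R v A w] v less.prems(2) by auto
    ultimately have "\<exists>A'\<subseteq>A. \<not> covered le R v A' \<and> (\<forall>a\<in>A'. covered le R v (residual le A' a))"
      using less.prems(1) by simp
    then obtain A' where A': "A' \<subseteq> A" "\<not> covered le R v A'"
        "\<And>a. a \<in> A' \<Longrightarrow> covered le R v (residual le A' a)"
      by (elim exE conjE) simp
    have tr': "transp_on A' le" using tr A'(1) less.prems by (meson order.trans transp_on_subset)
    have "A' \<noteq> {}" using A'(2) unfolding covered_def by blast
    moreover have "\<not> piece le R v {x \<in> A'. le t x}" if "t \<in> A'" for t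
    proof
      assume "piece le R v {x \<in> A'. le t x}"
      then have "covered le R v ({x \<in> A'. le t x} \<union> residual le A' t)"
        using covered_Un[OF covered_piece A'(3)[OF that]] by simp
      then have "covered le R v A'" by (rule covered_subset) (auto simp: residual_def)
      then show False using A'(2) by simp
    qed
    ultimately obtain t :: "nat \<Rightarrow> 'a" where "\<forall>i. t i \<in> A' \<and>
        (le (t i) (t (Suc i)) \<and> \<not> small le R v {x \<in> A'. le (t i) x \<and> \<not> le (t (Suc i)) x})"
      using exists_ladder[of A' le R v] by metis
    then have t: "\<And>i. t i \<in> A'" "\<And>i. le (t i) (t (Suc i))"
        "\<And>i. \<not> small le R v {x \<in> A'. le (t i) x \<and> \<not> le (t (Suc i)) x}"
      by simp_all
    let ?B = "\<lambda>i. {x \<in> A'. le (t i) x \<and> \<not> le (t (Suc i)) x}"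
    have "?B i \<subseteq> A \<and> large le R v (?B i)" for i
    proof
      show "?B i \<subseteq> A" using A'(1) by blast
      then show "large le R v (?B i)"
        using less.IH[OF v, of "?B i"] t(3)[of i] less.prems(1) by simp
    qed
    then show "\<exists>Bs :: nat \<Rightarrow> 'a set. (\<forall>i. Bs i \<subseteq> A \<and> large le R v (Bs i)) \<and> (\<forall>i j. i < j \<longrightarrow> precedes le (Bs i) (Bs j))"
      using ladder_precedes[of A' le t, OF tr' t(1,2)] by (intro exI[of _ ?B]) simp
  qed
qed

text \<open>Linearity raises the finitely many weights to their maximum, which exists because a
  non-empty set needs a non-empty cover.\<close>

lemma covered_less_if_small:
  assumes "trans R" "total R" "small le R w A" "A \<noteq> {}"
  shows "\<exists>v. (v, w) \<in> R \<and> covered le R v A"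
proof -
  obtain C where C: "finite C" "A \<subseteq> \<Union>C" "\<forall>B\<in>C. \<exists>v. (v, w) \<in> R \<and> piece le R v B"
    using assms(3) unfolding small_def by blast
  have key: "D \<noteq> {} \<longrightarrow> (\<exists>v. (v, w) \<in> R \<and> (\<forall>B\<in>D. piece le R v B))" if "finite D" "D \<subseteq> C" for D
    using that
  proof (induction D rule: finite_induct)
    case (insert B D)
    obtain v where v: "(v, w) \<in> R" "piece le R v B" using C(3) insert.prems by blast
    show ?case
    proof (cases "D = {}")
      case False
      then obtain u where u: "(u, w) \<in> R" "\<forall>B\<in>D. piece le R u B" using insert by auto
      consider "u = v" | "(u, v) \<in> R" | "(v, u) \<in> R" using assms(2) by (auto simp: total_on_def)
      then show ?thesis
      proof cases
        case 2
        then show ?thesis using u v piece_trans[OF assms(1) 2] by blast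
      next
        case 3
        then show ?thesis using u v piece_trans[OF assms(1) 3] by blast
      qed (use u v in blast)
    qed (use v in blast)
  qed simp
  have "C \<noteq> {}" using C(2) assms(4) by auto
  with key[OF C(1)] obtain v where "(v, w) \<in> R" "\<forall>B\<in>C. piece le R v B" by auto
  then show ?thesis using C(1,2) unfolding covered_def by (intro exI[of _ v] conjI exI[of _ C])
qed

text \<open>The least covering weight plays the role of the leading exponent in the Cantor normal
  form of o(A).\<close>

lemma exists_least_weight:
  assumes "wf R" "trans R" "total R" "A \<noteq> {}" "covered le R w A"
  obtains x where "covered le R x A" "\<not> small le R x A"
proof -
  obtain x where x: "covered le R x A" "\<And>y. (y, x) \<in> R \<Longrightarrow> \<not> covered le R y A"
    using wfE_min[OF assms(1), of w "{x. covered le R x A}"] assms(5) by auto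
  then show ?thesis using that covered_less_if_small[OF assms(2,3)] assms(4) by blast
qed

section \<open>Comparing bad sequences of two orders\<close>

text \<open>A simulation of the tree of bad sequences of A in that of B, replacing o(A) \<le> o(B).
  Coinduction allows it to be proved by an invariant alone.\<close>

coinductive dominated :: "('a \<Rightarrow> 'a \<Rightarrow> bool) \<Rightarrow> ('b \<Rightarrow> 'b \<Rightarrow> bool) \<Rightarrow> 'a set \<Rightarrow> 'b set \<Rightarrow> bool"
  for leA :: "'a \<Rightarrow> 'a \<Rightarrow> bool" and leB :: "'b \<Rightarrow> 'b \<Rightarrow> bool"
where
  "(\<And>a. a \<in> A \<Longrightarrow> \<exists>b\<in>B. dominated leA leB (residual leA A a) (residual leB B b)) \<Longrightarrow> dominated leA leB A B"

lemma dominatedD: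
  "dominated leA leB A B \<Longrightarrow> a \<in> A \<Longrightarrow> \<exists>b. b \<in> B \<and> dominated leA leB (residual leA A a) (residual leB B b)"
  by (erule dominated.cases) blast

fun reply :: "('a \<Rightarrow> 'a \<Rightarrow> bool) \<Rightarrow> ('b \<Rightarrow> 'b \<Rightarrow> bool) \<Rightarrow> 'a set \<Rightarrow> 'b set \<Rightarrow> 'a list \<Rightarrow> 'b list" where
  "reply leA leB A B [] = []"
| "reply leA leB A B (a # s) =
     (let b = SOME b. b \<in> B \<and> dominated leA leB (residual leA A a) (residual leB B b)
      in b # reply leA leB (residual leA A a) (residual leB B b) s)"

lemma length_reply [simp]: "length (reply leA leB A B s) = length s"
  by (induction s arbitrary: A B) (auto simp: Let_def)

lemma prefix_reply: "prefix s t \<Longrightarrow> prefix (reply leA leB A B s) (reply leA leB A B t)"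
proof (induction s arbitrary: A B t)
  case (Cons a s)
  then obtain t' where "t = a # t'" "prefix s t'" by (cases t) auto
  then show ?case using Cons.IH by (simp add: Let_def)
qed simp

lemma bad_reply:
  assumes "dominated leA leB A B" "set s \<subseteq> A" "sorted_wrt (\<lambda>x y. \<not> leA x y) s"
  shows "set (reply leA leB A B s) \<subseteq> B \<and> sorted_wrt (\<lambda>x y. \<not> leB x y) (reply leA leB A B s)"
  using assms
proof (induction s arbitrary: A B)
  case (Cons a s)
  define b where "b = (SOME b. b \<in> B \<and> dominated leA leB (residual leA A a) (residual leB B b))"
  have b: "b \<in> B \<and> dominated leA leB (residual leA A a) (residual leB B b)"
    unfolding b_def using Cons.prems(2) by (intro someI_ex[OF dominatedD[OF Cons.prems(1)]]) simp
  have "set s \<subseteq> residual leA A a" using Cons.prems by (auto simp: residual_def)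
  then have "set (reply leA leB (residual leA A a) (residual leB B b) s) \<subseteq> residual leB B b \<and>
      sorted_wrt (\<lambda>x y. \<not> leB x y) (reply leA leB (residual leA A a) (residual leB B b) s)"
    using Cons.IH[of "residual leA A a" "residual leB B b"] Cons.prems(3) b by simp
  moreover have "reply leA leB A B (a # s) = b # reply leA leB (residual leA A a) (residual leB B b) s"
    by (simp add: b_def Let_def)
  moreover have "residual leB B b \<subseteq> B" "\<forall>y\<in>residual leB B b. \<not> leB b y" by (auto simp: residual_def)
  ultimately show ?case using b by (simp del: reply.simps) blast
qed simp

section \<open>Cantor normal forms as lists of successive blocks\<close>

text \<open>Weights are compared by inclusion in a chain of sets, the form in which
  \<open>rank_class\<close> will supply ordinals.\<close>

definition subset_less :: "'w set set \<Rightarrow> 'w set rel" where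
  "subset_less W = {(X, Y). X \<in> W \<and> Y \<in> W \<and> X \<subset> Y}"

lemma trans_subset_less: "trans (subset_less W)"
  by (auto simp: subset_less_def trans_def)

text \<open>The blocks of \<open>host\<close> are listed in the order of \<open>precedes\<close>; their weights will be descending.\<close>

fun host :: "('a \<Rightarrow> 'a \<Rightarrow> bool) \<Rightarrow> 'w rel \<Rightarrow> 'w list \<Rightarrow> 'a set \<Rightarrow> bool" where
  "host le S [] B \<longleftrightarrow> True"
| "host le S (w # ws) B \<longleftrightarrow>
     (\<exists>B1 B2. B1 \<subseteq> B \<and> B2 \<subseteq> B \<and> precedes le B1 B2 \<and> large le S w B1 \<and> host le S ws B2)"

lemma host_superset: "host le S ws A \<Longrightarrow> A \<subseteq> B \<Longrightarrow> host le S ws B"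
  by (cases ws) (auto, meson order.trans)

lemma host_blocks:
  fixes Bs :: "nat \<Rightarrow> 'a set"
  assumes "\<And>i w. m \<le> i \<Longrightarrow> i < m + length ws \<Longrightarrow> w \<in> set ws \<Longrightarrow> large le S w (Bs i)"
    "\<And>i j. i < j \<Longrightarrow> j < m + length ws \<Longrightarrow> precedes le (Bs i) (Bs j)"
  shows "host le S ws (\<Union>i\<in>{m..<m + length ws}. Bs i)"
  using assms
proof (induction ws arbitrary: m)
  case (Cons w ws)
  let ?U = "\<Union>i\<in>{Suc m..<Suc m + length ws}. Bs i"
  have "host le S ws ?U" using Cons.prems by (intro Cons.IH) auto
  moreover have "precedes le (Bs m) ?U"
    using Cons.prems(2)[of m] unfolding precedes_def by (auto simp: Suc_le_eq)
  moreover have "large le S w (Bs m)" using Cons.prems(1) by simp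
  moreover have "Bs m \<subseteq> (\<Union>i\<in>{m..<m + length (w # ws)}. Bs i)" by (rule UN_upper) simp
  moreover have "?U \<subseteq> (\<Union>i\<in>{m..<m + length (w # ws)}. Bs i)" by (rule UN_mono) auto
  ultimately show ?case by (simp only: host.simps) metis
qed simp

lemma finite_chain_max:
  assumes "\<And>X Y. X \<in> W \<Longrightarrow> Y \<in> W \<Longrightarrow> X \<subseteq> Y \<or> Y \<subseteq> X"
  shows "finite V \<Longrightarrow> V \<subseteq> W \<Longrightarrow> V \<noteq> {} \<Longrightarrow> \<exists>u\<in>V. \<forall>v\<in>V. v \<subseteq> u"
proof (induction V rule: finite_induct)
  case (insert x V)
  show ?case
  proof (cases "V = {}")
    case False
    then obtain u where u: "u \<in> V" "\<forall>v\<in>V. v \<subseteq> u" using insert by auto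
    then have "x \<subseteq> u \<or> u \<subseteq> x" using assms insert.prems by auto
    then show ?thesis using u by (metis insert_iff order.trans order_refl)
  qed simp
qed simp

text \<open>Decreasing a Cantor normal form: omega^w gives way to any finite sum of smaller powers,
  at the price of all later terms.\<close>

lemma host_step:
  fixes le :: "'a \<Rightarrow> 'a \<Rightarrow> bool"
  assumes chain: "\<And>X Y. X \<in> W \<Longrightarrow> Y \<in> W \<Longrightarrow> X \<subseteq> Y \<or> Y \<subseteq> X"
    and vs: "\<And>v. v \<in> set vs \<Longrightarrow> (v, w) \<in> subset_less W"
  shows "host le (subset_less W) (pre @ w # post) B \<Longrightarrow>
    \<exists>b\<in>B. host le (subset_less W) (pre @ vs) (residual le B b)"
proof (induction pre arbitrary: B)
  case Nil
  then obtain B1 where B1: "B1 \<subseteq> B" "large le (subset_less W) w B1" by auto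
  show ?case
  proof (cases "vs = []")
    case True
    then show ?thesis using B1 large_nonempty by fastforce
  next
    case False
    have "set vs \<subseteq> W" using vs by (auto simp: subset_less_def)
    then have "\<exists>u\<in>set vs. \<forall>v\<in>set vs. v \<subseteq> u"
      using False by (intro finite_chain_max[OF chain]) auto
    then obtain u where u: "u \<in> set vs" "\<And>v. v \<in> set vs \<Longrightarrow> v \<subseteq> u" by metis
    obtain Bs :: "nat \<Rightarrow> 'a set" where Bs: "\<And>i. Bs i \<subseteq> B1" "\<And>i. large le (subset_less W) u (Bs i)"
        "\<And>i j. i < j \<Longrightarrow> precedes le (Bs i) (Bs j)"
      using largeD[OF B1(2) vs[OF u(1)]] by metis
    have "large le (subset_less W) v (Bs i)" if "v \<in> set vs" for v i
    proof (cases "v = u")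
      case False
      then have "(v, u) \<in> subset_less W" using u vs that by (auto simp: subset_less_def)
      then show ?thesis using large_trans[OF trans_subset_less] Bs(2) by blast
    qed (simp add: Bs(2))
    then have "host le (subset_less W) vs (\<Union>i\<in>{0..<0 + length vs}. Bs i)"
      using Bs(3) by (intro host_blocks) auto
    \<comment> \<open>One block beyond those kept, so that all of them stay in the residual of
      \<open>b\<close>.\<close>
    moreover obtain b where b: "b \<in> Bs (length vs)" using large_nonempty[OF Bs(2)] by blast
    have "(\<Union>i\<in>{0..<0 + length vs}. Bs i) \<subseteq> residual le B b"
    proof
      fix x assume "x \<in> (\<Union>i\<in>{0..<0 + length vs}. Bs i)"
      then obtain i where "i < length vs" "x \<in> Bs i" by auto
      then show "x \<in> residual le B b"
        using Bs(1)[of i] Bs(3)[of i "length vs"] b B1(1) by (auto simp: residual_def precedes_def)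
    qed
    ultimately have "host le (subset_less W) vs (residual le B b)" by (rule host_superset)
    moreover have "b \<in> B" using b Bs(1) B1(1) by blast
    ultimately show ?thesis by auto
  qed
next
  case (Cons u pre)
  then obtain B1 B2 where B: "B1 \<subseteq> B" "B2 \<subseteq> B" "precedes le B1 B2" "large le (subset_less W) u B1"
      "host le (subset_less W) (pre @ w # post) B2"
    by auto
  obtain b where b: "b \<in> B2" "host le (subset_less W) (pre @ vs) (residual le B2 b)"
    using Cons.IH[OF B(5)] by blast
  have "B1 \<subseteq> residual le B b" "residual le B2 b \<subseteq> residual le B b" "precedes le B1 (residual le B2 b)"
    using B b(1) by (auto simp: residual_def precedes_def)
  then have "host le (subset_less W) ((u # pre) @ vs) (residual le B b)"
    using B(4) b(2) by (simp only: append_Cons host.simps) metis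
  then show ?case using b(1) B(2) by blast
qed

lemma exists_descending_list:
  assumes chain: "\<And>X Y. X \<in> W \<Longrightarrow> Y \<in> W \<Longrightarrow> X \<subseteq> Y \<or> Y \<subseteq> X"
  shows "set_mset M \<subseteq> W \<Longrightarrow> \<exists>ws. mset ws = M \<and> sorted_wrt (\<lambda>X Y. Y \<subseteq> X) ws"
proof (induction "size M" arbitrary: M)
  case 0
  then show ?case by (intro exI[of _ "[]"]) auto
next
  case (Suc n)
  then have "set_mset M \<noteq> {}" by auto
  then have "\<exists>u\<in>set_mset M. \<forall>v\<in>set_mset M. v \<subseteq> u"
    using Suc.prems by (intro finite_chain_max[OF chain]) auto
  then obtain u where u: "u \<in># M" "\<And>v. v \<in># M \<Longrightarrow> v \<subseteq> u" by metis
  obtain N where N: "M = add_mset u N" using multi_member_split[OF u(1)] by blast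
  then obtain ws where ws: "mset ws = N" "sorted_wrt (\<lambda>X Y. Y \<subseteq> X) ws"
    using Suc(1)[of N] Suc(2,3) by auto
  have "\<forall>v\<in>set ws. v \<subseteq> u" using N u(2) ws(1) by (simp add: set_mset_mset[symmetric] del: set_mset_mset)
  then show ?case using N ws by (intro exI[of _ "u # ws"]) simp
qed

text \<open>The upper counterpart of \<open>host\<close>: a natural sum of powers of omega. The
  pairs record one set for each occurrence of a weight.\<close>

definition mcovered :: "('a \<Rightarrow> 'a \<Rightarrow> bool) \<Rightarrow> 'w rel \<Rightarrow> 'w multiset \<Rightarrow> 'a set \<Rightarrow> bool" where
  "mcovered le S M A \<longleftrightarrow> (\<exists>P. image_mset fst P = M \<and> (\<forall>p\<in>#P. piece le S (fst p) (snd p)) \<and>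
     A \<subseteq> \<Union>(snd ` set_mset P))"

text \<open>Only one chosen piece containing \<open>a\<close> is charged: its residual splits into
  finitely many lighter pieces, while the others are kept whole.\<close>

lemma mcovered_step:
  assumes "mcovered le S M A" "a \<in> A"
  shows "\<exists>w N V. M = add_mset w N \<and> (\<forall>v\<in>#V. (v, w) \<in> S) \<and> mcovered le S (N + V) (residual le A a)"
proof -
  obtain P where P: "image_mset fst P = M" "\<forall>p\<in>#P. piece le S (fst p) (snd p)" "A \<subseteq> \<Union>(snd ` set_mset P)"
    using assms(1) unfolding mcovered_def by (elim exE conjE)
  obtain p where p: "p \<in># P" "a \<in> snd p" using P(3) assms(2) by auto
  obtain P' where P': "P = add_mset p P'" using multi_member_split[OF p(1)] by blast
  have "small le S (fst p) (residual le (snd p) a)"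
    using P(2) p by (simp add: piece_iff_small)
  then obtain C where C: "finite C" "residual le (snd p) a \<subseteq> \<Union>C"
      "\<forall>B\<in>C. \<exists>v. (v, fst p) \<in> S \<and> piece le S v B"
    unfolding small_def by (elim exE conjE)
  obtain f where f: "\<forall>B\<in>C. (f B, fst p) \<in> S \<and> piece le S (f B) B"
    using bchoice[OF C(3)] by blast
  define D where "D = image_mset (\<lambda>B. (f B, B)) (mset_set C)"
  have D: "set_mset D = (\<lambda>B. (f B, B)) ` C" using C(1) by (simp add: D_def)
  have "M = add_mset (fst p) (image_mset fst P')" using P(1) P' by auto
  moreover have "\<forall>v\<in>#image_mset fst D. (v, fst p) \<in> S" using D f by auto
  moreover have "mcovered le S (image_mset fst P' + image_mset fst D) (residual le A a)"
    unfolding mcovered_def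
  proof (intro exI[of _ "P' + D"] conjI)
    show "\<forall>p\<in>#P' + D. piece le S (fst p) (snd p)" using P(2) P' D f by auto
    show "residual le A a \<subseteq> \<Union>(snd ` set_mset (P' + D))"
    proof
      fix x assume x: "x \<in> residual le A a"
      then obtain q where q: "q \<in># P" "x \<in> snd q" using P(3) by (auto simp: residual_def)
      show "x \<in> \<Union>(snd ` set_mset (P' + D))"
      proof (cases "q \<in># P'")
        case False
        then have "q = p" using q P' by simp
        then have "x \<in> residual le (snd p) a" using q(2) x by (simp add: residual_def)
        then show ?thesis using C(2) D by auto
      qed (use q in auto)
    qed
  qed simp
  ultimately show ?thesis by blast
qed

text \<open>The invariant is that one descending list bounds A from above as a natural sum and B
  from below as successive blocks.\<close>

lemma dominated_if_host:
  assumes chain: "\<And>X Y. X \<in> W \<Longrightarrow> Y \<in> W \<Longrightarrow> X \<subseteq> Y \<or> Y \<subseteq> X"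
    and "set ws \<subseteq> W" "sorted_wrt (\<lambda>X Y. Y \<subseteq> X) ws"
      "mcovered leA (subset_less W) (mset ws) A" "host leB (subset_less W) ws B"
  shows "dominated leA leB A B"
proof -
  let ?S = "subset_less W"
  define X where "X A B \<longleftrightarrow> (\<exists>ws. set ws \<subseteq> W \<and> sorted_wrt (\<lambda>X Y. Y \<subseteq> X) ws \<and>
    mcovered leA ?S (mset ws) A \<and> host leB ?S ws B)" for A B
  show ?thesis
  proof (rule dominated.coinduct[of X])
    show "X A B" unfolding X_def using assms by blast
    fix A B assume "X A B"
    then obtain ws where ws: "set ws \<subseteq> W" "sorted_wrt (\<lambda>X Y. Y \<subseteq> X) ws"
        "mcovered leA ?S (mset ws) A" "host leB ?S ws B"
      unfolding X_def by (elim exE conjE)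
    show "\<exists>A' B'. A = A' \<and> B = B' \<and> (\<forall>a. a \<in> A' \<longrightarrow> (\<exists>b\<in>B'. X (residual leA A' a) (residual leB B' b) \<or>
        dominated leA leB (residual leA A' a) (residual leB B' b)))"
    proof (intro exI conjI refl allI impI)
      fix a assume a: "a \<in> A"
      obtain w N V where wNV: "mset ws = add_mset w N" "\<forall>v\<in>#V. (v, w) \<in> ?S"
          "mcovered leA ?S (N + V) (residual leA A a)"
        using mcovered_step[OF ws(3) a] by (elim exE conjE)
      have "w \<in> set ws" using wNV(1) by (metis set_mset_mset union_single_eq_member)
      \<comment> \<open>Splitting at the last \<open>w\<close> makes all of \<open>post\<close>
        strictly lighter than \<open>w\<close>. The reply gives up the old blocks of
        \<open>post\<close> and finds room for these weights, together with V, inside the block of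
        \<open>w\<close>.\<close>
      then obtain pre post where split: "ws = pre @ w # post" "w \<notin> set post"
        using split_list_last by metis
      have N: "N = mset pre + mset post" using wNV(1) split(1) by simp
      have post: "(v, w) \<in> ?S" if "v \<in> set post" for v
        using ws(1,2) split that by (auto simp: sorted_wrt_append subset_less_def)
      have "set_mset (mset post + V) \<subseteq> W" using post wNV(2) by (auto simp: subset_less_def)
      then obtain vs where vs: "mset vs = mset post + V" "sorted_wrt (\<lambda>X Y. Y \<subseteq> X) vs"
        using exists_descending_list[of W] chain by metis
      have set_vs: "set vs = set post \<union> set_mset V"
        using arg_cong[OF vs(1), of set_mset] by simp
      have vw: "(v, w) \<in> ?S" if "v \<in> set vs" for v using set_vs that post wNV(2) by auto
      obtain b where b: "b \<in> B" "host leB ?S (pre @ vs) (residual leB B b)"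
        using host_step[OF chain vw, of vs leB pre post B] ws(4) split(1) by auto
      have "sorted_wrt (\<lambda>X Y. Y \<subseteq> X) (pre @ vs)"
        using ws(2) split(1) vs(2) vw by (fastforce simp: sorted_wrt_append subset_less_def)
      moreover have "set (pre @ vs) \<subseteq> W" using ws(1) split(1) vw by (auto simp: subset_less_def)
      moreover have "mcovered leA ?S (mset (pre @ vs)) (residual leA A a)"
        using wNV(3) N vs(1) by (simp add: ac_simps)
      ultimately have "X (residual leA A a) (residual leB B b)"
        unfolding X_def using b(2) by (intro exI[of _ "pre @ vs"] conjI)
      then show "\<exists>b\<in>B. X (residual leA A a) (residual leB B b) \<or>
          dominated leA leB (residual leA A a) (residual leB B b)"
        using b(1) by (intro bexI[of _ b] disjI1)
    qed (rule refl)+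
  qed
qed

section \<open>Ranks as a linear order of weights\<close>

text \<open>Stands for the ordinal rank of s, so that weights under a non-linear relation such as
  \<open>mstep R\<close> can be sorted.\<close>

definition rank_class :: "'w rel \<Rightarrow> 'w \<Rightarrow> 'w set" where
  "rank_class R s = {t. rank_le R t s}"

lemma rank_class_subset_iff: "rank_class R s \<subseteq> rank_class R t \<longleftrightarrow> rank_le R s t"
  unfolding rank_class_def using rank_le_refl[of R s] rank_le_trans[of R] by blast

lemma rank_class_chain: "wf R \<Longrightarrow> rank_class R s \<subseteq> rank_class R t \<or> rank_class R t \<subseteq> rank_class R s"
  by (simp add: rank_class_subset_iff rank_le_total)

lemma rank_class_less:
  assumes "wf R" "(v, w) \<in> R"
  shows "(rank_class R v, rank_class R w) \<in> subset_less (range (rank_class R))"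
  using rank_le_strict[OF assms] rank_le_total[OF assms(1), of v w]
  by (auto simp: subset_less_def psubset_eq rank_class_subset_iff) (metis rank_class_subset_iff order_refl)

lemma not_rank_le_predecessor:
  assumes "wf R"
  shows "\<not> rank_le R t s \<Longrightarrow> \<exists>t'. (t', t) \<in> R \<and> rank_le R s t'"
  using assms
proof (induction t arbitrary: s rule: wf_induct_rule)
  case (less t)
  then obtain t' where "(t', t) \<in> R" "\<And>s'. (s', s) \<in> R \<Longrightarrow> \<not> rank_le R t' s'"
    by (metis rank_le.intros)
  then show ?case using less.IH by (metis rank_le.intros)
qed

text \<open>Blocks are now owed for every smaller rank, not only for ranks of predecessors of w;
  each smaller rank is at most that of some predecessor.\<close>

lemma large_rank_class:
  assumes "wf R" "large le R w B"
  shows "large le (subset_less (range (rank_class R))) (rank_class R w) B"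
  using assms(2)
proof (induction rule: large.induct)
  case (largeI A w)
  let ?S = "subset_less (range (rank_class R))"
  show ?case
  proof (rule large.largeI)
    show "A \<noteq> {}" by fact
    fix X assume "(X, rank_class R w) \<in> ?S"
    then obtain s where s: "X = rank_class R s" "\<not> rank_le R w s"
      by (auto simp: subset_less_def psubset_eq rank_class_subset_iff)
         (metis rank_class_subset_iff subset_antisym)
    obtain w' where w': "(w', w) \<in> R" "rank_le R s w'"
      using not_rank_le_predecessor[OF assms(1) s(2)] by (elim exE conjE)
    from largeI.IH[OF w'(1)] obtain Bs where Bs: "\<forall>i :: nat. Bs i \<subseteq> A \<and> (large le R w' (Bs i) \<and> large le ?S (rank_class R w') (Bs i))"
        "\<forall>i j. i < j \<longrightarrow> precedes le (Bs i) (Bs j)"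
      by (elim exE conjE)
    have "X = rank_class R w' \<or> (X, rank_class R w') \<in> ?S"
      using w'(2) s(1) by (auto simp: subset_less_def psubset_eq rank_class_subset_iff)
    then have "large le ?S X (Bs i)" for i
      using Bs(1) large_trans[OF trans_subset_less, of X "rank_class R w'" _ le "Bs i"] by auto
    then show "\<exists>Bs :: nat \<Rightarrow> _. (\<forall>i. Bs i \<subseteq> A \<and> large le ?S X (Bs i)) \<and> (\<forall>i j. i < j \<longrightarrow> precedes le (Bs i) (Bs j))"
      using Bs by (intro exI[of _ Bs]) simp
  qed
qed

lemma dominated_if_blocks:
  fixes leB :: "'b \<Rightarrow> 'b \<Rightarrow> bool" and Bs :: "nat \<Rightarrow> 'b set"
  assumes R: "wf R" and C: "finite C" "A \<subseteq> \<Union>C" "\<And>X. X \<in> C \<Longrightarrow> piece leA R w X"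
    and Bs: "\<And>i. i < card C \<Longrightarrow> Bs i \<subseteq> B" "\<And>i. i < card C \<Longrightarrow> large leB R w (Bs i)"
      "\<And>i j. i < j \<Longrightarrow> j < card C \<Longrightarrow> precedes leB (Bs i) (Bs j)"
  shows "dominated leA leB A B"
proof (rule dominated_if_host[where W = "range (rank_class R)" and ws = "replicate (card C) (rank_class R w)"])
  let ?S = "subset_less (range (rank_class R))"
  show "X \<subseteq> Y \<or> Y \<subseteq> X" if "X \<in> range (rank_class R)" "Y \<in> range (rank_class R)" for X Y
    using that rank_class_chain[OF R] by auto
  show "set (replicate (card C) (rank_class R w)) \<subseteq> range (rank_class R)" by auto
  show "sorted_wrt (\<lambda>X Y. Y \<subseteq> X) (replicate (card C) (rank_class R w))"
    by (simp add: sorted_wrt_iff_nth_less)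
  have "piece leA ?S (rank_class R w) X" if "X \<in> C" for X
    using piece_weight[OF C(3)[OF that], of "rank_class R" ?S] rank_class_less[OF R] by blast
  then show "mcovered leA ?S (mset (replicate (card C) (rank_class R w))) A"
    unfolding mcovered_def using C(1,2)
    by (intro exI[of _ "image_mset (\<lambda>X. (rank_class R w, X)) (mset_set C)"])
       (auto simp: image_mset_const_eq multiset.map_comp comp_def)
  have "host leB ?S (replicate (card C) (rank_class R w))
      (\<Union>i\<in>{0..<0 + length (replicate (card C) (rank_class R w))}. Bs i)"
    using large_rank_class[OF R Bs(2)] Bs(3) by (intro host_blocks) simp_all
  then show "host leB ?S (replicate (card C) (rank_class R w)) B"
    by (rule host_superset) (rule UN_least, use Bs(1) in simp)
qed

section \<open>Products and natural sums of exponents\<close>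

text \<open>One entry decreases and nothing else changes, so the rank of a multiset is the natural
  sum of the ranks of its elements.\<close>

definition mstep :: "'w rel \<Rightarrow> 'w multiset rel" where
  "mstep R = {(add_mset v N, add_mset w N) | v w N. (v, w) \<in> R}"

lemma mstepI: "(v, w) \<in> R \<Longrightarrow> (add_mset v N, add_mset w N) \<in> mstep R"
  by (auto simp: mstep_def)

lemma mstep_add_mset: "(M, N) \<in> mstep R \<Longrightarrow> (add_mset x M, add_mset x N) \<in> mstep R"
  unfolding mstep_def by (auto simp: add_mset_commute) (metis add_mset_commute)

lemma mstep_cases:
  assumes "(K, add_mset w N) \<in> mstep R"
  obtains v where "K = add_mset v N" "(v, w) \<in> R" | N' where "K = add_mset w N'" "(N', N) \<in> mstep R"
proof -
  obtain v u L where K: "K = add_mset v L" "add_mset w N = add_mset u L" "(v, u) \<in> R"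
    using assms by (auto simp: mstep_def)
  from K(2) consider "w = u" "N = L" | L' where "N = add_mset u L'" "L = add_mset w L'"
    by (auto simp: add_eq_conv_ex)
  then show ?thesis
  proof cases
    case 2
    then show ?thesis using K that(2)[of "add_mset v L'"] by (simp add: mstepI add_mset_commute)
  qed (use K that in simp)
qed

lemma wf_mstep: "wf R \<Longrightarrow> wf (mstep R)"
  by (rule wf_subset[OF wf_mult1]) (auto simp: mstep_def mult1_def, metis add_mset_add_single set_mset_single singletonD)

definition prod_le :: "('a \<Rightarrow> 'a \<Rightarrow> bool) \<Rightarrow> ('b \<Rightarrow> 'b \<Rightarrow> bool) \<Rightarrow> 'a \<times> 'b \<Rightarrow> 'a \<times> 'b \<Rightarrow> bool" where
  "prod_le leA leB p q \<longleftrightarrow> leA (fst p) (fst q) \<and> leB (snd p) (snd q)"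

text \<open>A pair not above (a, b) fails in the first or in the second component, and either case
  lowers one summand of the exponent.\<close>

lemma piece_Times:
  assumes "piece leA R w A" "piece leB (mstep R) N B"
  shows "piece (prod_le leA leB) (mstep R) (add_mset w N) (A \<times> B)"
  using assms
proof (induction arbitrary: B N rule: piece.induct)
  case (pieceI A w)
  note outer = pieceI.IH
  from pieceI.prems show ?case
  proof (induction rule: piece.induct)
    case (pieceI B N)
    let ?le = "prod_le leA leB" and ?S = "mstep R"
    have pB: "piece leB ?S N B"
      by (rule piece.pieceI) (use pieceI.IH in meson)
    have "small ?le ?S (add_mset w N) (residual ?le (A \<times> B) (a, b))" if ab: "a \<in> A" "b \<in> B" for a b
    proof -
      from outer[OF ab(1)] obtain C where C: "finite C" "residual leA A a \<subseteq> \<Union>C"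
          "\<forall>X\<in>C. \<exists>v. (v, w) \<in> R \<and> piece leA R v X \<and>
             (\<forall>Y N. piece leB ?S N Y \<longrightarrow> piece ?le ?S (add_mset v N) (X \<times> Y))"
        by (elim exE conjE)
      from pieceI.IH[OF ab(2)] obtain D where D: "finite D" "residual leB B b \<subseteq> \<Union>D"
          "\<forall>Y\<in>D. \<exists>v. (v, N) \<in> ?S \<and> piece leB ?S v Y \<and> piece ?le ?S (add_mset w v) (A \<times> Y)"
        by (elim exE conjE)
      have "small ?le ?S (add_mset w N) (X \<times> B)" if X: "X \<in> C" for X
      proof -
        obtain v where v: "(v, w) \<in> R" "\<forall>Y N. piece leB ?S N Y \<longrightarrow> piece ?le ?S (add_mset v N) (X \<times> Y)"
          using bspec[OF C(3) X] by (elim exE conjE)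
        then show ?thesis using pB mstepI[OF v(1)] by (intro small_piece) auto
      qed
      moreover have "small ?le ?S (add_mset w N) (A \<times> Y)" if Y: "Y \<in> D" for Y
      proof -
        obtain v where v: "(v, N) \<in> ?S" "piece ?le ?S (add_mset w v) (A \<times> Y)"
          using bspec[OF D(3) Y] by (elim exE conjE)
        then show ?thesis using mstep_add_mset[OF v(1)] by (intro small_piece)
      qed
      ultimately have "small ?le ?S (add_mset w N) ((\<Union>X\<in>C. X \<times> B) \<union> (\<Union>Y\<in>D. A \<times> Y))"
        using C(1) D(1) by (intro small_Un small_UN)
      then show ?thesis
        by (rule small_subset) (use C(2) D(2) in \<open>auto simp: residual_def prod_le_def\<close>)
    qed
    then show ?case unfolding piece_iff_small by (metis mem_Times_iff prod.collapse)
  qed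
qed

text \<open>A step down in the exponent lowers one summand; the blocks for it are taken in that
  factor and multiplied by the whole of the other.\<close>

lemma large_Times:
  assumes "large leA R w A" "large leB (mstep R) N B"
  shows "large (prod_le leA leB) (mstep R) (add_mset w N) (A \<times> B)"
  using assms
proof (induction arbitrary: B N rule: large.induct)
  case (largeI A w)
  note outer = largeI.IH and A = largeI.hyps
  from largeI.prems show ?case
  proof (induction rule: large.induct)
    case (largeI B N)
    let ?le = "prod_le leA leB" and ?S = "mstep R"
    have lB: "large leB ?S N B"
      by (rule large.largeI) (use largeI in meson)+
    show ?case
    proof (rule large.largeI)
      show "A \<times> B \<noteq> {}" using A largeI.hyps by auto
      fix K assume "(K, add_mset w N) \<in> ?S"
      then show "\<exists>Bs :: nat \<Rightarrow> _. (\<forall>i. Bs i \<subseteq> A \<times> B \<and> large ?le ?S K (Bs i)) \<and>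
          (\<forall>i j. i < j \<longrightarrow> precedes ?le (Bs i) (Bs j))"
      proof (cases rule: mstep_cases)
        case (1 v)
        from outer[OF 1(2)] obtain Bs where Bs: "\<forall>i :: nat. Bs i \<subseteq> A \<and> (large leA R v (Bs i) \<and>
              (\<forall>Y N. large leB ?S N Y \<longrightarrow> large ?le ?S (add_mset v N) (Bs i \<times> Y)))"
            "\<forall>i j. i < j \<longrightarrow> precedes leA (Bs i) (Bs j)"
          by (elim exE conjE)
        show ?thesis
          using Bs lB 1(1) by (intro exI[of _ "\<lambda>i. Bs i \<times> B"]) (auto simp: precedes_def prod_le_def)
      next
        case (2 N')
        from largeI.IH[OF 2(2)] obtain Bs where Bs: "\<forall>i :: nat. Bs i \<subseteq> B \<and> (large leB ?S N' (Bs i) \<and>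
              large ?le ?S (add_mset w N') (A \<times> Bs i))"
            "\<forall>i j. i < j \<longrightarrow> precedes leB (Bs i) (Bs j)"
          by (elim exE conjE)
        show ?thesis
          using Bs 2(1) by (intro exI[of _ "\<lambda>i. A \<times> Bs i"]) (auto simp: precedes_def prod_le_def)
      qed
    qed
  qed
qed

text \<open>A point is a piece of every weight, so a product with it adds v to the exponent.\<close>

lemma piece_add_mset:
  assumes "piece le (mstep R) N A"
  shows "piece le (mstep R) (add_mset v N) A"
proof (rule piece_reflect[where f = "\<lambda>x. ((), x)"])
  have "piece (\<lambda>_ _. True) R v {()}"
    by (rule pieceI) (auto simp: residual_def)
  then show "piece (prod_le (\<lambda>_ _. True) le) (mstep R) (add_mset v N) ({()} \<times> A)"
    using assms by (rule piece_Times)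
qed (auto simp: prod_le_def)

section \<open>Additive principal order types\<close>

definition lex_copies :: "('a \<Rightarrow> 'a \<Rightarrow> bool) \<Rightarrow> 'a \<times> nat \<Rightarrow> 'a \<times> nat \<Rightarrow> bool" where
  "lex_copies le p q \<longleftrightarrow> snd p < snd q \<or> snd p = snd q \<and> le (fst p) (fst q)"

text \<open>A bad sequence plays the copy with the highest index first, since it can never return to
  a higher copy. A new copy on top thus adds \<gamma> on the right of \<delta>.\<close>

lemma ranks_into_lex_copies:
  fixes \<alpha> :: "'c rel" and \<gamma> :: "'c rel"
  assumes pr: "additive_principal \<alpha>" and \<gamma>: "\<gamma> <o \<alpha>" "ranks_into (bad_seqs D le) \<gamma>"
  shows "\<exists>\<delta> :: 'c rel. \<delta> <o \<alpha> \<and> ranks_into (bad_seqs (D \<times> {..<k}) (lex_copies le)) \<delta>"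
proof (induction k)
  case 0
  have "bad_seqs (D \<times> {..<0 :: nat}) (lex_copies le) = {}" by (auto simp: bad_seqs_def)
  then show ?case using \<gamma> by (intro exI[of _ \<gamma>]) (auto simp: ranks_into_def)
next
  case (Suc k)
  let ?T = "\<lambda>k. bad_seqs (D \<times> {..<k}) (lex_copies le)"
  obtain \<delta> :: "'c rel" where \<delta>: "\<delta> <o \<alpha>" "ranks_into (?T k) \<delta>" using Suc by (elim exE conjE)
  have sum: "ord_sum \<delta> \<gamma> <o \<alpha>" using pr \<delta>(1) \<gamma>(1) by (simp add: additive_principal_def)
  obtain f where f: "\<forall>s\<in>?T k. f s \<in> Field \<delta>"
      "\<forall>s\<in>?T k. \<forall>t\<in>?T k. strict_prefix s t \<longrightarrow> (f t, f s) \<in> \<delta> - Id"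
    using \<delta>(2) unfolding ranks_into_def by (elim exE conjE)
  obtain g where g: "\<forall>s\<in>bad_seqs D le. g s \<in> Field \<gamma>"
      "\<forall>s\<in>bad_seqs D le. \<forall>t\<in>bad_seqs D le. strict_prefix s t \<longrightarrow> (g t, g s) \<in> \<gamma> - Id"
    using \<gamma>(2) unfolding ranks_into_def by (elim exE conjE)
  define lo hi where "lo s = filter (\<lambda>p. snd p < k) s" and "hi s = map fst (filter (\<lambda>p. snd p = k) s)"
    for s :: "('a \<times> nat) list"
  \<comment> \<open>While no entry of a lower copy has appeared, the rank lies in the upper summand;
    afterwards the top copy is excluded and only the lower part counts.\<close>
  define h where "h s = (if lo s = [] then Inr (g (hi s)) else Inl (f (lo s)))" for s
  have bad: "set s \<subseteq> D \<times> {..<Suc k}" "sorted_wrt (\<lambda>x y. \<not> lex_copies le x y) s" "s \<noteq> []"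
    if "s \<in> ?T (Suc k)" for s
    using that by (auto simp: bad_seqs_sorted_wrt)
  have lo: "lo s \<in> ?T k" if "s \<in> ?T (Suc k)" "lo s \<noteq> []" for s
    using bad[OF that(1)] that(2) by (auto simp: bad_seqs_sorted_wrt lo_def sorted_wrt_filter)
  have hi: "hi s \<in> bad_seqs D le" if s: "s \<in> ?T (Suc k)" "lo s = []" for s
  proof -
    have "\<forall>p\<in>set s. snd p = k"
    proof
      fix p assume p: "p \<in> set s"
      then have "snd p < Suc k" using bad(1)[OF s(1)] by auto
      moreover have "\<not> snd p < k" using s(2) p by (auto simp: lo_def filter_empty_conv)
      ultimately show "snd p = k" by simp
    qed
    then have "hi s = map fst s" "sorted_wrt (\<lambda>x y. \<not> le (fst x) (fst y)) s"
      using bad(2)[OF s(1)] sorted_wrt_mono_rel[of s "\<lambda>x y. \<not> lex_copies le x y" "\<lambda>x y. \<not> le (fst x) (fst y)"]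
      by (auto simp: hi_def lex_copies_def)
    then show ?thesis using bad(1,3)[OF s(1)] by (auto simp: bad_seqs_sorted_wrt sorted_wrt_map)
  qed
  have "ranks_into (?T (Suc k)) (ord_sum \<delta> \<gamma>)"
    unfolding ranks_into_def
  proof (intro conjI exI[of _ h] ballI impI)
    show "Well_order (ord_sum \<delta> \<gamma>)" using sum by (simp add: ordLess_def)
    have F: "Inl x \<in> Field (ord_sum \<delta> \<gamma>)" if "x \<in> Field \<delta>" for x
    proof -
      obtain y where "(x, y) \<in> \<delta> \<or> (y, x) \<in> \<delta>" using \<open>x \<in> Field \<delta>\<close> by (auto simp: Field_def)
      then have "(Inl x, Inl y) \<in> ord_sum \<delta> \<gamma> \<or> (Inl y, Inl x) \<in> ord_sum \<delta> \<gamma>" by (auto simp: ord_sum_def)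
      then show ?thesis by (auto intro: FieldI1 FieldI2)
    qed
    have G: "Inr x \<in> Field (ord_sum \<delta> \<gamma>)" if "x \<in> Field \<gamma>" for x
    proof -
      obtain y where "(x, y) \<in> \<gamma> \<or> (y, x) \<in> \<gamma>" using \<open>x \<in> Field \<gamma>\<close> by (auto simp: Field_def)
      then have "(Inr x, Inr y) \<in> ord_sum \<delta> \<gamma> \<or> (Inr y, Inr x) \<in> ord_sum \<delta> \<gamma>" by (auto simp: ord_sum_def)
      then show ?thesis by (auto intro: FieldI1 FieldI2)
    qed
    show "h s \<in> Field (ord_sum \<delta> \<gamma>)" if "s \<in> ?T (Suc k)" for s
      using lo[OF that] hi[OF that] f(1) g(1) F G by (simp add: h_def)
    fix s t assume s: "s \<in> ?T (Suc k)" and t: "t \<in> ?T (Suc k)" and "strict_prefix s t"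
    then obtain u where u: "t = s @ u" "u \<noteq> []" by (auto simp: strict_prefix_def prefix_def)
    have lot: "lo t = lo s @ lo u" and hit: "hi t = hi s @ hi u" using u by (auto simp: lo_def hi_def)
    consider "lo t = []" | "lo t \<noteq> []" "lo s = []" | "lo s \<noteq> []" "lo t \<noteq> []" using lot by auto
    then show "(h t, h s) \<in> ord_sum \<delta> \<gamma> - Id"
    proof cases
      case 1
      have "hd u \<in> set t" using u by simp
      then have "snd (hd u) < Suc k" "\<not> snd (hd u) < k"
        using bad(1)[OF t] 1 by (auto simp: lo_def filter_empty_conv)
      then have "snd (hd u) = k" by simp
      then have "hi u \<noteq> []" using u(2) by (auto simp: hi_def filter_empty_conv intro!: bexI[of _ "hd u"])
      then have "strict_prefix (hi s) (hi t)" by (simp add: hit strict_prefix_def)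
      then have "(g (hi t), g (hi s)) \<in> \<gamma> - Id" using g(2) hi[OF s] hi[OF t] 1 lot by simp
      then show ?thesis using 1 lot by (simp add: h_def ord_sum_def)
    next
      case 2
      then show ?thesis using f(1) g(1) lo[OF t] hi[OF s] by (simp add: h_def ord_sum_def)
    next
      case 3
      then obtain p where p: "p \<in> set s" "snd p < k" by (auto simp: lo_def filter_empty_conv)
      have "\<not> lex_copies le p (hd u)" "snd (hd u) < Suc k"
        using bad(1,2)[OF t] u(1) p hd_in_set[OF u(2)] by (auto simp: sorted_wrt_append)
      then have "snd (hd u) < k" using p by (auto simp: lex_copies_def)
      then have "lo u \<noteq> []" using u(2) by (auto simp: lo_def filter_empty_conv intro!: bexI[of _ "hd u"])
      then have "strict_prefix (lo s) (lo t)" by (simp add: lot strict_prefix_def)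
      then have "(f (lo t), f (lo s)) \<in> \<delta> - Id" using f(2) lo[OF s] lo[OF t] 3 by simp
      then show ?thesis using 3 by (simp add: h_def ord_sum_def)
    qed
  qed
  \<comment> \<open>The sum lives on a sum type; the induction continues with an isomorphic copy on
    the original type.\<close>
  moreover obtain \<delta>' :: "'c rel" where "ord_sum \<delta> \<gamma> =o \<delta>'" "\<delta>' <o \<alpha>"
    using sum internalize_ordLess[of "ord_sum \<delta> \<gamma>" \<alpha>] by blast
  ultimately show ?case using ranks_into_ordIso by blast
qed

text \<open>Prefixing \<open>a\<close> places all bad sequences of the residual below the node
  \<open>[a]\<close>, hence into a proper initial segment of the ordinal.\<close>

lemma max_order_type_residual_less:
  assumes af: "almost_full_on le Q" and a: "a \<in> Q"
  shows "max_order_type (residual le Q a) le <o max_order_type Q le"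
proof -
  let ?\<alpha> = "max_order_type Q le" and ?D = "residual le Q a"
  have "ranks_into (bad_seqs Q le) ?\<alpha>"
    unfolding max_order_type_def by (rule tree_rank_least(1)[OF bad_seqs_no_infinite_branch[OF af]])
  then obtain f where wo: "Well_order ?\<alpha>" and f: "\<forall>s\<in>bad_seqs Q le. f s \<in> Field ?\<alpha>"
      "\<forall>s\<in>bad_seqs Q le. \<forall>t\<in>bad_seqs Q le. strict_prefix s t \<longrightarrow> (f t, f s) \<in> ?\<alpha> - Id"
    unfolding ranks_into_def by (elim exE conjE)
  let ?\<beta> = "Restr ?\<alpha> (underS ?\<alpha> (f [a]))"
  have Da: "a # s \<in> bad_seqs Q le" if "s \<in> bad_seqs ?D le" for s
    using that a by (auto simp: bad_seqs_sorted_wrt residual_def)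
  have single: "[a] \<in> bad_seqs Q le" using a by (simp add: bad_seqs_sorted_wrt)
  have U: "f (a # s) \<in> underS ?\<alpha> (f [a])" if s: "s \<in> bad_seqs ?D le" for s
  proof -
    have "strict_prefix [a] (a # s)" using s by (auto simp: bad_seqs_def strict_prefix_def)
    then show ?thesis using f(2) single Da[OF s] by (auto simp: underS_def)
  qed
  have refl: "(x, x) \<in> ?\<alpha>" if "x \<in> Field ?\<alpha>" for x
    using wo that by (auto simp: order_on_defs refl_on_def)
  have "ranks_into (bad_seqs ?D le) ?\<beta>"
    unfolding ranks_into_def
  proof (intro conjI exI[of _ "\<lambda>s. f (a # s)"] ballI impI)
    show "Well_order ?\<beta>" using wo by (rule Well_order_Restr)
    show "f (a # s) \<in> Field ?\<beta>" if "s \<in> bad_seqs ?D le" for s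
      using U[OF that] refl[of "f (a # s)"] f(1) Da[OF that] by (auto simp: Field_def)
    show "(f (a # t), f (a # s)) \<in> ?\<beta> - Id"
      if "s \<in> bad_seqs ?D le" "t \<in> bad_seqs ?D le" "strict_prefix s t" for s t
      using f(2) Da that U by (auto simp: strict_prefix_def)
  qed
  moreover have "almost_full_on le ?D" using af by (rule almost_full_on_subset) (auto simp: residual_def)
  ultimately have "max_order_type ?D le \<le>o ?\<beta>"
    unfolding max_order_type_def using tree_rank_least(2) bad_seqs_no_infinite_branch by blast
  moreover have "Field ?\<alpha> \<noteq> {}" using f(1) single by auto
  then have "?\<beta> <o ?\<alpha>" using underS_Restr_ordLess[OF wo] by blast
  ultimately show ?thesis by (rule ordLeq_ordLess_trans)
qed

text \<open>
  Otherwise some residual \<open>D\<close> is large of the least weight \<open>\<beta>\<close> that covers \<open>Q\<close>, so that finitely many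
  copies of \<open>D\<close> put on top of each other dominate \<open>Q\<close>.
\<close>

lemma piece_if_additive_principal:
  fixes le :: "'a \<Rightarrow> 'a \<Rightarrow> bool"
  assumes af: "almost_full_on le Q" and tr: "transp_on Q le"
    and pr: "additive_principal (max_order_type Q le)"
    and R: "wf R" and \<beta>: "covered le R \<beta> Q" "\<not> small le R \<beta> Q"
  shows "piece le R \<beta> Q"
proof (rule ccontr)
  assume "\<not> ?thesis"
  then obtain a where a: "a \<in> Q" "\<not> small le R \<beta> (residual le Q a)" by (auto simp: piece_iff_small)
  let ?D = "residual le Q a" and ?\<alpha> = "max_order_type Q le"
  have sub: "?D \<subseteq> Q" by (auto simp: residual_def)
  have D: "large le R \<beta> ?D" using not_small_imp_large[OF R af tr sub a(2)] .
  obtain C where C: "finite C" "Q \<subseteq> \<Union>C" "\<forall>X\<in>C. piece le R \<beta> X"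
    using \<beta>(1) unfolding covered_def by (elim exE conjE)
  let ?B = "?D \<times> {..<card C}" and ?le = "lex_copies le"
  \<comment> \<open>One copy of the residual for each piece in the cover of
    \<open>Q\<close>.\<close>
  have dom: "dominated le ?le Q ?B"
  proof (rule dominated_if_blocks[OF R C(1,2), where Bs = "\<lambda>i. ?D \<times> {i}" and w = \<beta>])
    fix i
    show "large ?le R \<beta> (?D \<times> {i})"
      by (rule large_reflect[OF D, where g = "\<lambda>x. (x, i)"]) (auto simp: lex_copies_def)
  qed (use C(3) in \<open>auto simp: precedes_def lex_copies_def\<close>)
  have "almost_full_on le ?D" using af sub by (rule almost_full_on_subset)
  then have "ranks_into (bad_seqs ?D le) (max_order_type ?D le)"
    unfolding max_order_type_def by (intro tree_rank_least(1) bad_seqs_no_infinite_branch)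
  then obtain \<delta> :: "'a list rel" where \<delta>: "\<delta> <o ?\<alpha>" "ranks_into (bad_seqs ?B ?le) \<delta>"
    using ranks_into_lex_copies[OF pr max_order_type_residual_less[OF af a(1)]] by metis
  have "ranks_into (bad_seqs Q le) \<delta>"
  proof (rule ranks_into_mono[OF \<delta>(2), where \<Phi> = "reply le ?le Q ?B"])
    fix s assume s: "s \<in> bad_seqs Q le"
    then have "reply le ?le Q ?B s \<noteq> []" by (cases s) (auto simp: bad_seqs_def Let_def)
    then show "reply le ?le Q ?B s \<in> bad_seqs ?B ?le"
      using bad_reply[OF dom, of s] s by (simp add: bad_seqs_sorted_wrt)
  next
    fix s t :: "'a list" assume "strict_prefix s t"
    then show "strict_prefix (reply le ?le Q ?B s) (reply le ?le Q ?B t)"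
      using prefix_reply[of s t le ?le Q ?B] prefix_length_less[of s t]
      by (auto simp: strict_prefix_def dest: arg_cong[of _ _ length])
  qed
  then have "?\<alpha> \<le>o \<delta>"
    unfolding max_order_type_def by (rule tree_rank_least(2)[OF bad_seqs_no_infinite_branch[OF af]])
  then show False using not_ordLess_ordLeq[OF \<delta>(1)] by simp
qed

section \<open>Calculus of the multiset embedding\<close>

text \<open>A matching as a multiset of pairs can be filtered and split without reference to
  enumerations.\<close>

lemma mset_emb_iff:
  "mset_emb le M N \<longleftrightarrow> (\<exists>P. image_mset fst P = M \<and> image_mset snd P \<subseteq># N \<and> (\<forall>p\<in>#P. le (fst p) (snd p)))"
proof
  assume "mset_emb le M N"
  then obtain xs ys f where xs: "mset xs = M" "mset ys = N" and f: "inj_on f {..<length xs}"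
      "\<forall>i<length xs. f i < length ys \<and> le (xs ! i) (ys ! f i)"
    unfolding mset_emb_def by (elim exE conjE)
  let ?P = "image_mset (\<lambda>i. (xs ! i, ys ! f i)) (mset_set {..<length xs})"
  have nth: "image_mset ((!) zs) (mset_set {..<length zs}) = mset zs" for zs :: "'a list"
    by (metis atLeast0LessThan map_nth mset_map mset_upt)
  have "image_mset snd ?P = image_mset ((!) ys) (mset_set (f ` {..<length xs}))"
    using f(1) by (simp add: image_mset_mset_set[symmetric] multiset.map_comp comp_def)
  also have "\<dots> \<subseteq># image_mset ((!) ys) (mset_set {..<length ys})"
    using f(2) by (intro image_mset_subseteq_mono subset_imp_msubset_mset_set) auto
  finally have "image_mset snd ?P \<subseteq># N" by (simp add: nth xs)
  moreover have "image_mset fst ?P = M" using nth[of xs] xs by (simp add: multiset.map_comp comp_def)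
  ultimately show "\<exists>P. image_mset fst P = M \<and> image_mset snd P \<subseteq># N \<and> (\<forall>p\<in>#P. le (fst p) (snd p))"
    using f(2) by (intro exI[of _ ?P]) auto
next
  assume "\<exists>P. image_mset fst P = M \<and> image_mset snd P \<subseteq># N \<and> (\<forall>p\<in>#P. le (fst p) (snd p))"
  then obtain P where P: "image_mset fst P = M" "image_mset snd P \<subseteq># N" "\<forall>p\<in>#P. le (fst p) (snd p)"
    by (elim exE conjE)
  obtain ps where ps: "mset ps = P" using ex_mset by blast
  obtain rs where rs: "mset rs = N - image_mset snd P" using ex_mset by blast
  show "mset_emb le M N"
    unfolding mset_emb_def
  proof (rule exI[of _ "map fst ps"], rule exI[of _ "map snd ps @ rs"], intro conjI exI[of _ "\<lambda>i. i"])
    show "mset (map fst ps) = M" using P ps by simp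
    show "mset (map snd ps @ rs) = N" using P ps rs by simp
    show "\<forall>i<length (map fst ps). i < length (map snd ps @ rs) \<and> le (map fst ps ! i) ((map snd ps @ rs) ! i)"
      using P(3) ps by (auto simp: nth_append)
  qed auto
qed

lemma mset_emb_size: "mset_emb le M N \<Longrightarrow> size M \<le> size N"
  unfolding mset_emb_iff by (metis size_image_mset size_mset_mono)

lemma mset_emb_union:
  assumes "mset_emb le M N" "mset_emb le M' N'"
  shows "mset_emb le (M + M') (N + N')"
proof -
  obtain P P' where "image_mset fst P = M" "image_mset snd P \<subseteq># N" "\<forall>p\<in>#P. le (fst p) (snd p)"
      "image_mset fst P' = M'" "image_mset snd P' \<subseteq># N'" "\<forall>p\<in>#P'. le (fst p) (snd p)"
    using assms unfolding mset_emb_iff by (elim exE conjE)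
  then show ?thesis
    unfolding mset_emb_iff by (intro exI[of _ "P + P'"]) (auto intro: subset_mset.add_mono)
qed

lemma mset_emb_all:
  assumes "\<And>x y. x \<in># M \<Longrightarrow> y \<in># N \<Longrightarrow> le x y" "size M \<le> size N"
  shows "mset_emb le M N"
proof -
  obtain xs ys where xs: "mset xs = M" "mset ys = N" using ex_mset by metis
  then have "length xs \<le> length ys" using assms(2) by (metis size_mset)
  then have "\<forall>i<length xs. i < length ys \<and> le (xs ! i) (ys ! i)"
    using assms(1) xs by (auto intro!: assms(1))
  then show ?thesis unfolding mset_emb_def using xs
    by (intro exI[of _ xs] exI[of _ ys] conjI exI[of _ "\<lambda>i. i"]) auto
qed

lemma mset_emb_empty: "mset_emb le {#} N"
  by (rule mset_emb_all) auto

lemma mset_emb_mono: "mset_emb le M N \<Longrightarrow> N \<subseteq># N' \<Longrightarrow> mset_emb le M N'"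
  unfolding mset_emb_iff by (elim exE conjE, intro exI conjI) (auto intro: subset_mset.order_trans)

lemma mset_emb_single: "mset_emb le {#x#} {#y#} \<longleftrightarrow> le x y"
proof
  assume "mset_emb le {#x#} {#y#}"
  then obtain P where P: "image_mset fst P = {#x#}" "image_mset snd P \<subseteq># {#y#}" "\<forall>p\<in>#P. le (fst p) (snd p)"
    unfolding mset_emb_iff by (elim exE conjE)
  from P(1) obtain p where "P = {#p#}" "fst p = x" by (auto dest: msed_map_invR)
  then show "le x y" using P(2,3) by auto
qed (auto intro: mset_emb_all)

text \<open>Elements of an upward closed set can only be matched inside it. If the target offers no
  more of them than the source needs, they are all used up, so the rest is matched to the
  rest.\<close>

lemma mset_emb_filter:
  assumes emb: "mset_emb le M N" and up: "\<And>x y. x \<in># M \<Longrightarrow> y \<in># N \<Longrightarrow> U x \<Longrightarrow> le x y \<Longrightarrow> U y"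
  shows "mset_emb le (filter_mset U M) (filter_mset U N)"
    and "size (filter_mset U N) \<le> size (filter_mset U M) \<Longrightarrow>
      mset_emb le (filter_mset (\<lambda>x. \<not> U x) M) (filter_mset (\<lambda>x. \<not> U x) N)"
proof -
  obtain P where P: "image_mset fst P = M" "image_mset snd P \<subseteq># N" "\<forall>p\<in>#P. le (fst p) (snd p)"
    using emb unfolding mset_emb_iff by (elim exE conjE)
  have image_fst_filter: "image_mset fst (filter_mset (\<lambda>p. V (fst p)) P) = filter_mset V (image_mset fst P)" for V
    by (induction P) auto
  define P1 P2 where "P1 = filter_mset (\<lambda>p. U (fst p)) P" and "P2 = filter_mset (\<lambda>p. \<not> U (fst p)) P"
  have fst: "image_mset fst P1 = filter_mset U M" "image_mset fst P2 = filter_mset (\<lambda>x. \<not> U x) M"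
    using P(1) image_fst_filter by (auto simp: P1_def P2_def)
  have sum: "image_mset snd P1 + image_mset snd P2 = image_mset snd P"
    unfolding P1_def P2_def by (metis image_mset_union multiset_partition)
  have "U (snd p)" if p: "p \<in># P1" for p
  proof -
    have "p \<in># P" "U (fst p)" using p by (auto simp: P1_def)
    moreover have "fst p \<in># M" using P(1) \<open>p \<in># P\<close> by auto
    moreover have "snd p \<in># N" using mset_subset_eqD[OF P(2)] \<open>p \<in># P\<close> by auto
    ultimately show ?thesis using up P(3) by blast
  qed
  then have "filter_mset U (image_mset snd P1) = image_mset snd P1"
    by (intro filter_mset_eq_conv[THEN iffD2]) auto
  moreover have "image_mset snd P1 \<subseteq># N" using P(2) sum by (metis mset_subset_eq_add_left subset_mset.order_trans)
  ultimately have sub: "image_mset snd P1 \<subseteq># filter_mset U N"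
    by (metis multiset_filter_mono)
  show "mset_emb le (filter_mset U M) (filter_mset U N)"
    unfolding mset_emb_iff using fst(1) sub P(3) by (intro exI[of _ P1]) (auto simp: P1_def)
  assume size: "size (filter_mset U N) \<le> size (filter_mset U M)"
  have "size (image_mset snd P1) = size (filter_mset U M)" using arg_cong[OF fst(1), of size] by simp
  then have "image_mset snd P1 = filter_mset U N"
    using sub size by (metis leD mset_subset_size subset_mset.le_imp_less_or_eq)
  then have "filter_mset U N + image_mset snd P2 \<subseteq># N" using sum P(2) by simp
  then have "filter_mset U N + image_mset snd P2 \<subseteq># filter_mset U N + filter_mset (\<lambda>x. \<not> U x) N"
    by (metis multiset_partition)
  then have "image_mset snd P2 \<subseteq># filter_mset (\<lambda>x. \<not> U x) N"
    by (simp only: subset_mset.add_le_cancel_left)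
  then show "mset_emb le (filter_mset (\<lambda>x. \<not> U x) M) (filter_mset (\<lambda>x. \<not> U x) N)"
    unfolding mset_emb_iff using fst(2) P(3) by (intro exI[of _ P2]) (auto simp: P2_def)
qed

text \<open>The index map of a list embedding is injective, so Higman's lemma can be applied to
  arbitrary enumerations.\<close>

lemma almost_full_on_multisets:
  assumes "almost_full_on le Q"
  shows "almost_full_on (mset_emb le) (multisets Q)"
  unfolding almost_full_on_def
proof (intro allI impI)
  fix F :: "nat \<Rightarrow> 'a multiset" assume F: "\<forall>i. F i \<in> multisets Q"
  have "\<forall>i. \<exists>xs. mset xs = F i" using ex_mset by blast
  then obtain G where G: "\<forall>i. mset (G i) = F i" using choice[of "\<lambda>i xs. mset xs = F i"] by blast
  have "G i \<in> lists Q" for i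
    using F G by (metis in_listsI mem_Collect_eq multisets_def set_mset_mset subsetD)
  then obtain i j where ij: "i < j" "list_emb le (G i) (G j)"
    using almost_full_onD[OF Higman[OF assms], of G] by metis
  then obtain f where f: "strict_mono_on {..<length (G i)} f"
      "\<forall>k<length (G i). f k < length (G j) \<and> le (G i ! k) (G j ! f k)"
    unfolding list_emb_iff_strict_mono by (elim exE conjE)
  then have "mset_emb le (F i) (F j)"
    unfolding mset_emb_def using G strict_mono_on_imp_inj_on[OF f(1)] by blast
  then show "\<exists>i j. i < j \<and> mset_emb le (F i) (F j)" using ij by blast
qed

section \<open>Weights of multisets\<close>

lemma piece_singleton: "le x x \<Longrightarrow> piece le R w {x}"
  using small_empty[of le R w] by (auto simp: piece_iff_small residual_def intro: small_subset)

text \<open>A bottom element adds at most one point to a residual; v is the weight of that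
  point.\<close>

lemma piece_insert_bottom:
  assumes "piece le R w A" "\<And>x. x \<in> insert z A \<Longrightarrow> le z x" "(v, w) \<in> R"
  shows "piece le R w (insert z A)"
  unfolding piece_iff_small
proof
  fix a assume a: "a \<in> insert z A"
  show "small le R w (residual le (insert z A) a)"
  proof (cases "a = z")
    case True
    then have "residual le (insert z A) a = {}" using assms(2) by (auto simp: residual_def)
    then show ?thesis by (simp add: small_empty)
  next
    case False
    then have "small le R w (residual le A a)" using a assms(1) by (simp add: piece_iff_small)
    moreover have "small le R w {z}" using assms(2,3) by (intro small_piece piece_singleton) auto
    ultimately have "small le R w ({z} \<union> residual le A a)" by (intro small_Un)
    then show ?thesis by (rule small_subset) (auto simp: residual_def)
  qed
qed

text \<open>The residuals are finite, and the type omega is at most omega^w once w has a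
  predecessor.\<close>

lemma piece_nat:
  assumes "(v, w) \<in> R"
  shows "piece ((\<le>) :: nat \<Rightarrow> nat \<Rightarrow> bool) R w UNIV"
  unfolding piece_iff_small
proof
  fix n :: nat
  have "small (\<le>) R w (\<Union>i\<in>{..<n}. {i})"
    using assms by (intro small_UN small_piece piece_singleton) auto
  then show "small (\<le>) R w (residual (\<le>) UNIV n)"
    by (rule small_subset) (auto simp: residual_def)
qed

text \<open>A non-empty multiset goes to a chosen element paired with the rest. Any choice reflects
  the order, since matchings of both parts combine; the empty multiset is put back as a bottom
  element.\<close>

lemma piece_multisets_bounded:
  assumes "piece le R w S" "(v, w) \<in> R"
  shows "piece (mset_emb le) (mstep R) (replicate_mset n w) {M. set_mset M \<subseteq> S \<and> size M \<le> n}"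
proof (induction n)
  case 0
  have "{M. set_mset M \<subseteq> S \<and> size M \<le> 0} = {{#}}" by auto
  then show ?case by (simp add: piece_singleton mset_emb_empty)
next
  case (Suc n)
  let ?A = "\<lambda>n. {M. set_mset M \<subseteq> S \<and> size M \<le> n}" and ?N = "replicate_mset (Suc n) w"
  define f where "f M = (let x = SOME x. x \<in># M in (x, M - {#x#}))" for M :: "'a multiset"
  have f: "\<exists>x. x \<in># M \<and> f M = (x, M - {#x#})" if "M \<noteq> {#}" for M
    using someI_ex[of "\<lambda>x. x \<in># M"] that by (auto simp: f_def Let_def)
  have "piece (mset_emb le) (mstep R) ?N (?A (Suc n) - {{#}})"
  proof (rule piece_reflect)
    show "piece (prod_le le (mset_emb le)) (mstep R) ?N (S \<times> ?A n)"
      using piece_Times[OF assms(1) Suc] by simp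
    show "f ` (?A (Suc n) - {{#}}) \<subseteq> S \<times> ?A n"
    proof
      fix p assume "p \<in> f ` (?A (Suc n) - {{#}})"
      then obtain M where M: "set_mset M \<subseteq> S" "size M \<le> Suc n" "M \<noteq> {#}" "p = f M" by auto
      obtain x where x: "x \<in># M" "f M = (x, M - {#x#})" using f[OF M(3)] by blast
      have "set_mset (M - {#x#}) \<subseteq> S" using M(1) by (meson in_diffD subset_iff)
      then show "p \<in> S \<times> ?A n" using M x by (auto simp: size_Diff_singleton)
    qed
    fix M N assume "M \<in> ?A (Suc n) - {{#}}" "N \<in> ?A (Suc n) - {{#}}" and emb: "prod_le le (mset_emb le) (f M) (f N)"
    then obtain x y where "x \<in># M" "f M = (x, M - {#x#})" "y \<in># N" "f N = (y, N - {#y#})"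
      using f[of M] f[of N] by auto
    then have "mset_emb le ({#x#} + (M - {#x#})) ({#y#} + (N - {#y#}))"
      using emb by (intro mset_emb_union) (auto simp: prod_le_def mset_emb_single)
    then show "mset_emb le M N" using \<open>x \<in># M\<close> \<open>y \<in># N\<close> by simp
  qed
  then have "piece (mset_emb le) (mstep R) ?N (insert {#} (?A (Suc n) - {{#}}))"
    by (rule piece_insert_bottom[where v = "add_mset v (replicate_mset n w)"])
       (auto simp: mset_emb_empty intro: mstepI assms(2))
  moreover have "insert {#} (?A (Suc n) - {{#}}) = ?A (Suc n)" by auto
  ultimately show ?case by simp
qed

lemma mstep_replicate_mset:
  assumes "(K, replicate_mset (Suc n) w) \<in> mstep R"
  obtains v where "(v, w) \<in> R" "K = add_mset v (replicate_mset n w)"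
proof -
  obtain v u N where K: "K = add_mset v N" "replicate_mset (Suc n) w = add_mset u N" "(v, u) \<in> R"
    using assms by (auto simp: mstep_def)
  have "u \<in># replicate_mset (Suc n) w" using K(2) by (metis union_single_eq_member)
  then have "u = w" by (simp add: in_replicate_mset del: replicate_mset_Suc)
  then show ?thesis using K that by simp
qed

text \<open>Blocks for a lowered exponent take one element from the layer between \<open>t i\<close>
  and \<open>t (Suc i)\<close> and the other n above \<open>t (Suc i)\<close>. Upper cones inherit
  the hypothesis on final segments, so the second factor is large by induction.\<close>

lemma large_multisets_size:
  fixes le :: "'a \<Rightarrow> 'a \<Rightarrow> bool"
  assumes R: "wf R" and af: "almost_full_on le Q" and tr: "transp_on Q le"
  shows "T \<subseteq> Q \<Longrightarrow> T \<noteq> {} \<Longrightarrow>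
    (\<And>t v. t \<in> T \<Longrightarrow> (v, w) \<in> R \<Longrightarrow> \<not> piece le R v {x \<in> T. le t x}) \<Longrightarrow> \<exists>v. (v, w) \<in> R \<Longrightarrow>
    large (mset_emb le) (mstep R) (replicate_mset n w) {M. set_mset M \<subseteq> T \<and> size M = n}"
proof (induction n arbitrary: T)
  case 0
  show ?case by (rule largeI) (auto simp: mstep_def)
next
  case (Suc n)
  let ?A = "\<lambda>T n. {M. set_mset M \<subseteq> T \<and> size M = n}"
  have trT: "transp_on T le" using tr Suc.prems(1) by (rule transp_on_subset)
  show ?case
  proof (rule largeI)
    obtain t where "t \<in> T" using Suc.prems(2) by blast
    then have "replicate_mset (Suc n) t \<in> ?A T (Suc n)" by (auto simp: in_replicate_mset)
    then show "?A T (Suc n) \<noteq> {}" by blast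
    fix K assume "(K, replicate_mset (Suc n) w) \<in> mstep R"
    then obtain v where v: "(v, w) \<in> R" "K = add_mset v (replicate_mset n w)" by (rule mstep_replicate_mset)
    obtain t :: "nat \<Rightarrow> 'a" where "\<forall>i. t i \<in> T \<and>
        (le (t i) (t (Suc i)) \<and> \<not> small le R v {x \<in> T. le (t i) x \<and> \<not> le (t (Suc i)) x})"
      using exists_ladder[of T le R v] Suc.prems(2,3) v(1) by metis
    then have t: "\<And>i. t i \<in> T" "\<And>i. le (t i) (t (Suc i))"
        "\<And>i. \<not> small le R v {x \<in> T. le (t i) x \<and> \<not> le (t (Suc i)) x}"
      by simp_all
    define B U where "B i = {x \<in> T. le (t i) x \<and> \<not> le (t (Suc i)) x}" and "U i = {x \<in> T. le (t (Suc i)) x}" for i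
    have lB: "large le R v (B i)" for i
      unfolding B_def by (rule not_small_imp_large[OF R af tr]) (use t(3) Suc.prems(1) in auto)
    have lU: "large (mset_emb le) (mstep R) (replicate_mset n w) (?A (U i) n)" for i
    proof (rule Suc.IH)
      show "U i \<subseteq> Q" using Suc.prems(1) by (auto simp: U_def)
      show "U i \<noteq> {}" using t by (auto simp: U_def)
      show "\<exists>v. (v, w) \<in> R" by fact
      fix s u assume s: "s \<in> U i" and u: "(u, w) \<in> R"
      have "s \<in> T" "le (t (Suc i)) s" using s by (auto simp: U_def)
      then have "{x \<in> U i. le s x} = {x \<in> T. le s x}"
        using transp_onD[OF trT t(1)] by (auto simp: U_def)
      then show "\<not> piece le R u {x \<in> U i. le s x}" using Suc.prems(3)[OF \<open>s \<in> T\<close> u] by simp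
    qed
    define D where "D i = (\<lambda>p. add_mset (fst p) (snd p)) ` (B i \<times> ?A (U i) n)" for i
    have D: "\<exists>b M'. M = add_mset b M' \<and> b \<in> B i \<and> set_mset M' \<subseteq> U i \<and> size M' = n" if "M \<in> D i" for M i
    proof -
      obtain p where p: "p \<in> B i \<times> ?A (U i) n" "M = add_mset (fst p) (snd p)"
        using \<open>M \<in> D i\<close> unfolding D_def by (rule imageE)
      then show ?thesis by (intro exI[of _ "fst p"] exI[of _ "snd p"]) auto
    qed
    have sub: "D i \<subseteq> ?A T (Suc n)" for i
      by (auto simp: D_def B_def U_def)
    have filt: "filter_mset (le (t (Suc i))) (add_mset b M) = M"
        "filter_mset (\<lambda>x. \<not> le (t (Suc i)) x) (add_mset b M) = {#b#}"
      if "b \<in> B i" "set_mset M \<subseteq> U i" for b M i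
    proof -
      have M: "\<forall>x\<in>#M. le (t (Suc i)) x" using that(2) by (auto simp: U_def)
      then have "filter_mset (le (t (Suc i))) M = M" by (simp add: filter_mset_eq_conv)
      moreover have "filter_mset (\<lambda>x. \<not> le (t (Suc i)) x) M = {#}" using M by simp
      ultimately show "filter_mset (le (t (Suc i))) (add_mset b M) = M"
          "filter_mset (\<lambda>x. \<not> le (t (Suc i)) x) (add_mset b M) = {#b#}"
        using that(1) by (auto simp: B_def)
    qed
    have up: "le (t (Suc i)) y" if "x \<in> T" "y \<in> T" "le (t (Suc i)) x" "le x y" for x y i
      using transp_onD[OF trT t(1)] that by blast
    \<comment> \<open>All members of a block have equally many elements above
      \<open>t (Suc i)\<close>, so \<open>mset_emb_filter\<close> separates the two factors.\<close>
    have lD: "large (mset_emb le) (mstep R) K (D i)" for i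
      unfolding v(2)
    proof (rule large_reflect[OF large_Times[OF lB[of i] lU[of i]]])
      show "(\<lambda>p. add_mset (fst p) (snd p)) ` (B i \<times> ?A (U i) n) \<subseteq> D i" by (simp add: D_def)
      fix p q assume p: "p \<in> B i \<times> ?A (U i) n" and q: "q \<in> B i \<times> ?A (U i) n"
        and emb: "mset_emb le (add_mset (fst p) (snd p)) (add_mset (fst q) (snd q))"
      have "add_mset (fst p) (snd p) \<in> ?A T (Suc n)" "add_mset (fst q) (snd q) \<in> ?A T (Suc n)"
        using sub[of i] p q unfolding D_def by blast+
      then have up': "\<And>x y. x \<in># add_mset (fst p) (snd p) \<Longrightarrow> y \<in># add_mset (fst q) (snd q) \<Longrightarrow>
          le (t (Suc i)) x \<Longrightarrow> le x y \<Longrightarrow> le (t (Suc i)) y"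
        using up by blast
      have fp: "fst p \<in> B i" "set_mset (snd p) \<subseteq> U i" "size (snd p) = n"
        and fq: "fst q \<in> B i" "set_mset (snd q) \<subseteq> U i" "size (snd q) = n"
        using p q by auto
      have "mset_emb le (filter_mset (le (t (Suc i))) (add_mset (fst p) (snd p)))
          (filter_mset (le (t (Suc i))) (add_mset (fst q) (snd q)))"
        by (rule mset_emb_filter(1)[OF emb]) (use up' in blast)
      then have "mset_emb le (snd p) (snd q)" by (simp only: filt(1)[OF fp(1,2)] filt(1)[OF fq(1,2)])
      moreover have "mset_emb le (filter_mset (\<lambda>x. \<not> le (t (Suc i)) x) (add_mset (fst p) (snd p)))
          (filter_mset (\<lambda>x. \<not> le (t (Suc i)) x) (add_mset (fst q) (snd q)))"
      proof (rule mset_emb_filter(2)[OF emb])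
        show "size (filter_mset (le (t (Suc i))) (add_mset (fst q) (snd q)))
            \<le> size (filter_mset (le (t (Suc i))) (add_mset (fst p) (snd p)))"
          by (simp only: filt(1)[OF fp(1,2)] filt(1)[OF fq(1,2)] fp(3) fq(3))
      qed (use up' in blast)
      then have "mset_emb le {#fst p#} {#fst q#}" by (simp only: filt(2)[OF fp(1,2)] filt(2)[OF fq(1,2)])
      ultimately show "prod_le le (mset_emb le) p q" by (simp add: prod_le_def mset_emb_single)
    qed
    have "precedes (mset_emb le) (D i) (D j)" if ij: "i < j" for i j
      unfolding precedes_def
    proof (intro ballI notI)
      fix M N assume M: "M \<in> D i" and N: "N \<in> D j" and emb: "mset_emb le N M"
      obtain b M' where M': "M = add_mset b M'" "b \<in> B i" "set_mset M' \<subseteq> U i" "size M' = n" using D[OF M] by blast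
      obtain c N' where N': "N = add_mset c N'" "c \<in> B j" "set_mset N' \<subseteq> U j" "size N' = n" using D[OF N] by blast
      have MT: "set_mset M \<subseteq> T" "set_mset N \<subseteq> T" using sub[of i] sub[of j] M N by auto
      have lad: "le (t (Suc i)) y" if "y \<in> T" "le (t k) y" "Suc i \<le> k" for y k
        using ladder_le[of T le t "Suc i" k y, OF trT t(1,2)] that by simp
      \<comment> \<open>All n + 1 elements of N lie above \<open>t (Suc i)\<close>, but only n
        elements of M do.\<close>
      have "le (t j) x \<or> le (t (Suc j)) x" if "x \<in># N" for x
        using that N' by (auto simp: B_def U_def)
      then have "\<forall>x\<in>#N. le (t (Suc i)) x" using lad ij MT(2) by (meson Suc_leI le_SucI subsetD)
      then have fN: "filter_mset (le (t (Suc i))) N = N" by (simp add: filter_mset_eq_conv)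
      have "mset_emb le (filter_mset (le (t (Suc i))) N) (filter_mset (le (t (Suc i))) M)"
        by (rule mset_emb_filter(1)[OF emb]) (use up MT in blast)
      then have "mset_emb le N M'" using fN filt(1)[OF M'(2,3)] M'(1) by simp
      then show False using mset_emb_size N'(1,4) M'(4) by fastforce
    qed
    then show "\<exists>Bs :: nat \<Rightarrow> _. (\<forall>i. Bs i \<subseteq> ?A T (Suc n) \<and> large (mset_emb le) (mstep R) K (Bs i)) \<and>
        (\<forall>i j. i < j \<longrightarrow> precedes (mset_emb le) (Bs i) (Bs j))"
      using lD sub by (intro exI[of _ D]) simp
  qed
qed

section \<open>Translations that spend the first move\<close>

text \<open>The first entry fixes the order on \<open>C m\<close> into which all later entries are
  translated; its own answer \<open>y m\<close> only has to be incomparable to theirs.\<close>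

lemma ord_width_eq_max_order_type_first_move:
  fixes le :: "'a \<Rightarrow> 'a \<Rightarrow> bool" and leC :: "'c \<Rightarrow> 'c \<Rightarrow> bool" and f :: "nat \<Rightarrow> 'c \<Rightarrow> 'a"
  assumes af: "almost_full_on le X"
    and dom: "\<And>m. m \<in> X \<Longrightarrow> dominated le leC (residual le X m) (C m)"
    and y: "\<And>m. m \<in> X \<Longrightarrow> y m \<in> X"
    and f: "\<And>m k c. m \<in> X \<Longrightarrow> c \<in> C m \<Longrightarrow> f k c \<in> X"
      "\<And>m k c. m \<in> X \<Longrightarrow> c \<in> C m \<Longrightarrow> \<not> le (y m) (f k c)"
      "\<And>m i j c d. m \<in> X \<Longrightarrow> c \<in> C m \<Longrightarrow> d \<in> C m \<Longrightarrow> le (f i c) (f j d) \<Longrightarrow> leC c d"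
    and size: "\<And>x y. le x y \<Longrightarrow> \<mu> x \<le> \<mu> y" "\<And>k c. k \<le> \<mu> (f k c)"
  shows "ord_width X le =o max_order_type X le"
proof -
  \<comment> \<open>Padding starts above the size of \<open>y m\<close>, which keeps every later
    entry from lying below it.\<close>
  define \<Psi> where "\<Psi> m s = pad f \<mu> (Suc (\<mu> (y m))) (reply le leC (residual le X m) (C m) s)" for m s
  define \<Phi> where "\<Phi> s = (case s of [] \<Rightarrow> [] | m # s' \<Rightarrow> y m # \<Psi> m s')" for s
  show ?thesis
  proof (rule ord_width_eq_max_order_typeI[OF af, of \<Phi>])
    fix s assume "s \<in> bad_seqs X le"
    then obtain m s' where s: "s = m # s'" "m \<in> X" "set s' \<subseteq> residual le X m"
        "sorted_wrt (\<lambda>x y. \<not> le x y) s'"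
      by (cases s) (auto simp: bad_seqs_sorted_wrt residual_def)
    let ?r = "reply le leC (residual le X m) (C m) s'"
    have r: "set ?r \<subseteq> C m" "sorted_wrt (\<lambda>x y. \<not> leC x y) ?r"
      using bad_reply[OF dom[OF s(2)] s(3,4)] by auto
    have inc: "sorted_wrt (\<lambda>x y. \<not> le x y \<and> \<not> le y x) (\<Psi> m s')"
      unfolding \<Psi>_def
      by (rule pad_incomparable[of "C m" le f leC \<mu>]) (use f(3)[OF s(2)] size r in simp_all)
    have z: "z \<in> X \<and> \<not> le (y m) z \<and> \<not> le z (y m)" if "z \<in> set (\<Psi> m s')" for z
    proof -
      obtain i c where ic: "Suc (\<mu> (y m)) \<le> i" "c \<in> set ?r" "z = f i c"
        using set_pad[of z f \<mu> _ ?r] \<open>z \<in> set (\<Psi> m s')\<close> unfolding \<Psi>_def by blast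
      have c: "c \<in> C m" using ic(2) r(1) by blast
      have "\<mu> (y m) < \<mu> z" using ic size(2)[of i c] by simp
      then have "\<not> le z (y m)" using size(1)[of z "y m"] by linarith
      then show ?thesis using f(1,2)[OF s(2) c] ic(3) by simp
    qed
    show "\<Phi> s \<in> incomparable_seqs X le"
      using inc z y[OF s(2)] s(1) by (auto simp: \<Phi>_def incomparable_seqs_sorted_wrt)
  next
    fix s t assume s: "s \<in> bad_seqs X le" and st: "strict_prefix s t"
    obtain m s' where s': "s = m # s'" using s by (cases s) (auto simp: bad_seqs_def)
    then obtain t' where t': "t = m # t'" "strict_prefix s' t'" using st by (cases t) auto
    have len: "length (\<Psi> m u) = length u" for u by (simp add: \<Psi>_def)
    have "prefix (\<Psi> m s') (\<Psi> m t')" unfolding \<Psi>_def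
      using t'(2) by (intro prefix_pad prefix_reply) (simp add: strict_prefix_def)
    moreover have "\<Psi> m s' \<noteq> \<Psi> m t'" using prefix_length_less[OF t'(2)] len by (metis less_irrefl)
    ultimately show "strict_prefix (\<Phi> s) (\<Phi> t)"
      using s' t'(1) by (simp add: \<Phi>_def strict_prefix_def)
  qed
qed

section \<open>The width of the multiset order\<close>

lemma mset_emb_remove:
  assumes "mset_emb le M N" "x \<in># M"
  obtains y where "y \<in># N" "le x y" "mset_emb le (M - {#x#}) (N - {#y#})"
proof -
  obtain P where P: "image_mset fst P = M" "image_mset snd P \<subseteq># N" "\<forall>p\<in>#P. le (fst p) (snd p)"
    using assms(1) unfolding mset_emb_iff by (elim exE conjE)
  obtain p where p: "p \<in># P" "fst p = x" using assms(2) P(1) by auto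
  obtain P' where P': "P = add_mset p P'" using multi_member_split[OF p(1)] by blast
  have "image_mset snd P' \<subseteq># N - {#snd p#}" "snd p \<in># N"
    using P(2) unfolding P' by (auto simp: insert_subset_eq_iff)
  moreover have "image_mset fst P' = M - {#x#}" using P(1) p(2) P' by auto
  ultimately have "mset_emb le (M - {#x#}) (N - {#snd p#})"
    unfolding mset_emb_iff using P(3) P' by (intro exI[of _ P']) auto
  then show ?thesis using that[of "snd p"] \<open>snd p \<in># N\<close> P(3) p by auto
qed

lemma transp_on_mset_emb:
  assumes "transp_on Q le"
  shows "transp_on (multisets Q) (mset_emb le)"
proof -
  have "mset_emb le M L" if "mset_emb le M N" "mset_emb le N L" "set_mset (M + N + L) \<subseteq> Q" for M N L
    using that
  proof (induction M arbitrary: N L)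
    case empty
    show ?case by (rule mset_emb_empty)
  next
    case (add x M)
    obtain y where y: "y \<in># N" "le x y" "mset_emb le M (N - {#y#})"
      using mset_emb_remove[OF add.prems(1), of x] by auto
    obtain z where z: "z \<in># L" "le y z" "mset_emb le (N - {#y#}) (L - {#z#})"
      using mset_emb_remove[OF add.prems(2) y(1)] by auto
    have "mset_emb le M (L - {#z#})"
      by (rule add.IH[OF y(3) z(3)]) (use add.prems(3) in \<open>auto dest: in_diffD\<close>)
    moreover have "le x z" using assms y z add.prems(3) by (auto intro: transp_onD)
    ultimately have "mset_emb le ({#x#} + M) ({#z#} + (L - {#z#}))"
      by (intro mset_emb_union) (simp_all add: mset_emb_single)
    then show ?case using z(1) by simp
  qed
  then show ?thesis by (auto simp: transp_on_def multisets_def)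
qed

lemma exists_minimal:
  assumes "well_quasi_order_on Q le" "Q \<noteq> {}"
  obtains a where "a \<in> Q" "\<And>x. x \<in> Q \<Longrightarrow> le x a \<Longrightarrow> le a x"
proof (rule ccontr)
  assume *: "\<not> thesis"
  have "\<exists>f :: nat \<Rightarrow> 'a. \<forall>i. f i \<in> Q \<and> (le (f (Suc i)) (f i) \<and> \<not> le (f i) (f (Suc i)))"
    by (rule dependent_nat_choice) (use assms(2) * that in blast)+
  then show False using assms(1) by (simp add: well_quasi_order_on_def)
qed

text \<open>
  The argument for multisets: pick \<open>a\<close> minimal in \<open>Q\<close>.  After the first move \<open>m\<close>, split \<open>Q\<close> into the class
  \<open>E\<close> of \<open>a\<close>, the upper bounds \<open>S\<close> of \<open>m\<close> outside \<open>E\<close>, and the rest \<open>T\<close>.  A multiset not above \<open>m\<close> has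
  fewer than \<open>size m\<close> elements in \<open>S\<close>; the reply keeps a fixed larger number of elements in \<open>S\<close>
  and uses copies of \<open>a\<close> as padding.
\<close>

lemma ord_width_multisets:
  fixes le :: "'a \<Rightarrow> 'a \<Rightarrow> bool"
  assumes wqo: "well_quasi_order_on Q le" and pr: "additive_principal (max_order_type Q le)"
    and ab: "a\<^sub>0 \<in> Q" "b\<^sub>0 \<in> Q" "\<not> le b\<^sub>0 a\<^sub>0"
  shows "ord_width (multisets Q) (mset_emb le) =o max_order_type (multisets Q) (mset_emb le)"
proof -
  let ?X = "multisets Q" and ?emb = "mset_emb le"
  have af: "almost_full_on le Q" using wqo by (rule well_quasi_order_on_almost_full_on)
  have refl: "\<And>x. x \<in> Q \<Longrightarrow> le x x" and tr: "transp_on Q le"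
    using wqo by (auto simp: well_quasi_order_on_def quasi_order_on_def reflp_on_def)
  have afX: "almost_full_on ?emb ?X" using af by (rule almost_full_on_multisets)
  have trX: "transp_on ?X ?emb" using tr by (rule transp_on_mset_emb)
  obtain R :: "'a multiset set rel" where R: "wf R" "trans R" "total R"
      and weight: "\<And>B. B \<subseteq> ?X \<Longrightarrow> piece ?emb R B B"
    using exists_weights[OF afX] by metis
  have "piece le R ?X Q"
    by (rule piece_reflect[OF weight[OF order_refl], where f = "\<lambda>q. {#q#}"])
       (auto simp: multisets_def mset_emb_single)
  then have "covered le R ?X Q" by (rule covered_piece)
  then obtain \<beta> where \<beta>: "covered le R \<beta> Q" "\<not> small le R \<beta> Q"
    using exists_least_weight[OF R, of Q le ?X] ab(1) by blast
  have pQ: "piece le R \<beta> Q" by (rule piece_if_additive_principal[OF af tr pr R(1) \<beta>])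
  \<comment> \<open>Here \<open>\<not> le b\<^sub>0 a\<^sub>0\<close> enters: a non-empty residual
    forces some weight below \<beta>.\<close>
  obtain v where v: "(v, \<beta>) \<in> R"
  proof -
    have "small le R \<beta> (residual le Q b\<^sub>0)" "a\<^sub>0 \<in> residual le Q b\<^sub>0"
      using pQ ab by (auto simp: piece_iff_small residual_def)
    then show ?thesis using that unfolding small_def by blast
  qed
  obtain a where a: "a \<in> Q" "\<And>x. x \<in> Q \<Longrightarrow> le x a \<Longrightarrow> le a x"
    using exists_minimal[OF wqo] ab(1) by blast
  define E where "E = {x \<in> Q. le x a}"
  define S where "S m = {x \<in> Q. (\<forall>q\<in>#m. le q x) \<and> \<not> le x a}" for m
  define T where "T m = {x \<in> Q. \<not> le x a \<and> x \<notin> S m}" for m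
  \<comment> \<open>By minimality \<open>E\<close> is one equivalence class, so only the number of
    its elements in a multiset matters.\<close>
  have E: "le x y" if "x \<in> E" "y \<in> E" for x y
    using that a tr by (auto simp: E_def intro: transp_onD[of Q le x a y])
  have smallE: "small le R \<beta> E"
  proof (rule small_piece[OF v])
    have "residual le E x = {}" if "x \<in> E" for x using E that by (auto simp: residual_def)
    then show "piece le R v E" by (simp add: piece_iff_small small_empty)
  qed
  have residual_small: "small le R \<beta> (residual le Q q)" if "q \<in> Q" for q
    using pQ that by (simp add: piece_iff_small)
  \<comment> \<open>An element of \<open>Q\<close> outside \<open>S m\<close> is in \<open>E\<close>
    or fails to lie above some element of m; these sets are small, and \<open>Q\<close> is
    not.\<close>
  have S_big: "\<not> small le R \<beta> (S m)" if m: "m \<in> ?X" for m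
  proof
    assume "small le R \<beta> (S m)"
    moreover have "small le R \<beta> (\<Union>q\<in>set_mset m. residual le Q q)"
      using m residual_small by (intro small_UN) (auto simp: multisets_def)
    ultimately have "small le R \<beta> (S m \<union> ((\<Union>q\<in>set_mset m. residual le Q q) \<union> E))"
      using smallE by (intro small_Un)
    then have "small le R \<beta> Q" by (rule small_subset) (auto simp: S_def E_def residual_def)
    then show False using \<beta>(2) by simp
  qed
  have S_final: "\<not> piece le R u {x \<in> S m. le s x}" if m: "m \<in> ?X" and s: "s \<in> S m" and u: "(u, \<beta>) \<in> R" for m s u
  proof
    assume "piece le R u {x \<in> S m. le s x}"
    then have "small le R \<beta> ({x \<in> S m. le s x} \<union> residual le Q s)"
      using small_piece[OF u] residual_small s by (intro small_Un) (auto simp: S_def)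
    then have "small le R \<beta> (S m)" by (rule small_subset) (auto simp: S_def residual_def)
    then show False using S_big[OF m] by simp
  qed
  have S_ne: "S m \<noteq> {}" if "m \<in> ?X" for m
    using S_big[OF that] small_empty[of le R \<beta>] by auto
  have S_up: "y \<in> S m" if "m \<in> ?X" "x \<in> S m" "y \<in> Q" "le x y" for m x y
  proof -
    have x: "x \<in> Q" "\<not> le x a" "\<forall>q\<in>#m. le q x" using that by (auto simp: S_def)
    have "\<not> le y a" using x that a(1) transp_onD[OF tr, of x y a] by blast
    moreover have "le q y" if "q \<in># m" for q
      using x \<open>m \<in> ?X\<close> \<open>y \<in> Q\<close> \<open>le x y\<close> that transp_onD[OF tr, of q x y] by (auto simp: multisets_def)
    ultimately show ?thesis using that(3) by (simp add: S_def)
  qed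
  have disj: "x \<notin> S m" if "x \<in> T m" for x m using that by (simp add: T_def)
  \<comment> \<open>Two extra elements of \<open>S m\<close>: one matches the factor omega that
    counts elements of \<open>E\<close>, the other is lowered to obtain arbitrarily many successive
    blocks.\<close>
  define C where "C m = {M. set_mset M \<subseteq> T m} \<times> {M. set_mset M \<subseteq> S m \<and> size M = size m + 2}" for m
  \<comment> \<open>One element more in \<open>S m\<close> than any later answer has, so it embeds
    into none of them.\<close>
  define y where "y m = replicate_mset (size m + 3) (SOME s. s \<in> S m)" for m
  define f where "f k c = fst c + snd c + replicate_mset k a" for k :: nat and c :: "'a multiset \<times> 'a multiset"
  have yS: "set_mset (y m) \<subseteq> S m" if "m \<in> ?X" for m
    using some_in_eq[of "S m"] S_ne[OF that] by (auto simp: y_def in_replicate_mset)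
  have fQ: "set_mset (f k c) \<subseteq> Q" if "c \<in> C m" for k c m
    using that a(1) by (auto simp: f_def C_def S_def T_def in_replicate_mset split: if_splits)
  have fS: "filter_mset (\<lambda>x. x \<in> S m) (f k c) = snd c"
    "filter_mset (\<lambda>x. x \<notin> S m) (f k c) = fst c + replicate_mset k a" if c: "c \<in> C m" for k c m
  proof -
    have "a \<notin> S m" using refl a(1) by (simp add: S_def)
    moreover have "filter_mset (\<lambda>x. x \<in> S m) (fst c) = {#}" "filter_mset (\<lambda>x. x \<notin> S m) (fst c) = fst c"
      using c by (auto simp: C_def T_def filter_mset_eq_conv)
    moreover have "filter_mset (\<lambda>x. x \<in> S m) (snd c) = snd c" "filter_mset (\<lambda>x. x \<notin> S m) (snd c) = {#}"
      using c by (auto simp: C_def filter_mset_eq_conv)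
    moreover have "filter_mset (\<lambda>x. x \<in> S m) (replicate_mset k a) = {#}"
        "filter_mset (\<lambda>x. x \<notin> S m) (replicate_mset k a) = replicate_mset k a"
      using \<open>a \<notin> S m\<close> by (auto simp: filter_mset_eq_conv in_replicate_mset)
    ultimately show "filter_mset (\<lambda>x. x \<in> S m) (f k c) = snd c"
        "filter_mset (\<lambda>x. x \<notin> S m) (f k c) = fst c + replicate_mset k a"
      by (simp_all add: f_def)
  qed
  have fT: "filter_mset (\<lambda>x. x \<in> T m) (fst c + replicate_mset k a) = fst c" if c: "c \<in> C m" for k c m
  proof -
    have "a \<notin> T m" using refl a(1) by (simp add: T_def)
    then have "filter_mset (\<lambda>x. x \<in> T m) (replicate_mset k a) = {#}"
      by (auto simp: in_replicate_mset)
    moreover have "filter_mset (\<lambda>x. x \<in> T m) (fst c) = fst c"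
      using c by (auto simp: C_def filter_mset_eq_conv)
    ultimately show ?thesis by simp
  qed
  show ?thesis
  proof (rule ord_width_eq_max_order_type_first_move[where C = C and y = y and f = f and \<mu> = size
        and leC = "prod_le ?emb ?emb"])
    show "almost_full_on ?emb ?X" by (rule afX)
    show "y m \<in> ?X" if "m \<in> ?X" for m
      using yS[OF that] by (auto simp: multisets_def S_def)
    show "f k c \<in> ?X" if "c \<in> C m" for m k c
      using fQ[OF that] by (simp add: multisets_def)
    show "\<not> ?emb (y m) (f k c)" if m: "m \<in> ?X" and c: "c \<in> C m" for m k c
    proof
      assume "?emb (y m) (f k c)"
      then have "?emb (filter_mset (\<lambda>x. x \<in> S m) (y m)) (filter_mset (\<lambda>x. x \<in> S m) (f k c))"
        by (rule mset_emb_filter(1)) (use S_up[OF m] fQ[OF c] in blast)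
      moreover have "filter_mset (\<lambda>x. x \<in> S m) (y m) = y m"
        using yS[OF m] by (auto simp: filter_mset_eq_conv)
      ultimately have "size (y m) \<le> size (snd c)" using fS(1)[OF c] mset_emb_size by simp
      then show False using c by (simp add: y_def C_def mem_Times_iff)
    qed
    show "prod_le ?emb ?emb c d"
      if m: "m \<in> ?X" and c: "c \<in> C m" and d: "d \<in> C m" and emb: "?emb (f i c) (f j d)" for m i j c d
    proof -
      have up: "\<And>x y. x \<in># f i c \<Longrightarrow> y \<in># f j d \<Longrightarrow> x \<in> S m \<Longrightarrow> le x y \<Longrightarrow> y \<in> S m"
        using S_up[OF m] fQ[OF d] by blast
      have "?emb (filter_mset (\<lambda>x. x \<in> S m) (f i c)) (filter_mset (\<lambda>x. x \<in> S m) (f j d))"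
        by (rule mset_emb_filter(1)[OF emb]) (use up in blast)
      then have "?emb (snd c) (snd d)" by (simp only: fS(1)[OF c] fS(1)[OF d])
      \<comment> \<open>Both sides have exactly \<open>size m + 2\<close> elements in
        \<open>S m\<close>, so these cancel.\<close>
      moreover have "?emb (filter_mset (\<lambda>x. x \<notin> S m) (f i c)) (filter_mset (\<lambda>x. x \<notin> S m) (f j d))"
      proof (rule mset_emb_filter(2)[OF emb])
        show "size (filter_mset (\<lambda>x. x \<in> S m) (f j d)) \<le> size (filter_mset (\<lambda>x. x \<in> S m) (f i c))"
          using c d by (simp only: fS(1)[OF c] fS(1)[OF d]) (simp add: C_def mem_Times_iff)
      qed (use up in blast)
      then have "?emb (fst c + replicate_mset i a) (fst d + replicate_mset j a)"
        by (simp only: fS(2)[OF c] fS(2)[OF d])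
      \<comment> \<open>No element of \<open>T m\<close> lies below \<open>a\<close>, so the padding
        cannot absorb any.\<close>
      then have "?emb (filter_mset (\<lambda>x. x \<in> T m) (fst c + replicate_mset i a))
          (filter_mset (\<lambda>x. x \<in> T m) (fst d + replicate_mset j a))"
        by (rule mset_emb_filter(1))
           (use d in \<open>auto simp: C_def T_def in_replicate_mset split: if_splits\<close>)
      then have "?emb (fst c) (fst d)" using fT[OF c] fT[OF d] by simp
      ultimately show ?thesis by (simp add: prod_le_def)
    qed
    show "?emb x y \<Longrightarrow> size x \<le> size y" for x y by (rule mset_emb_size)
    show "k \<le> size (f k c)" for k c by (simp add: f_def)
    fix m assume m: "m \<in> ?X"
    let ?n = "size m" and ?A = "residual ?emb ?X m"
    have TX: "multisets (T m) \<subseteq> ?X" by (auto simp: multisets_def T_def)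
    have "covered ?emb R (multisets (T m)) (multisets (T m))" using weight[OF TX] by (rule covered_piece)
    moreover have "multisets (T m) \<noteq> {}" by (auto simp: multisets_def intro: exI[of _ "{#}"])
    ultimately obtain x where x: "covered ?emb R x (multisets (T m))" "\<not> small ?emb R x (multisets (T m))"
      using exists_least_weight[OF R] by metis
    have "large ?emb R x (multisets (T m))"
      using not_small_imp_large[OF R(1) afX trX TX x(2)] .
    moreover have "large ?emb (mstep R) (replicate_mset (?n + 2) \<beta>) {M. set_mset M \<subseteq> S m \<and> size M = ?n + 2}"
      by (rule large_multisets_size[OF R(1) af tr]) (use S_ne[OF m] S_final[OF m] v in \<open>auto simp: S_def\<close>)
    ultimately have lC: "large (prod_le ?emb ?emb) (mstep R) (add_mset x (replicate_mset (?n + 2) \<beta>)) (C m)"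
      unfolding C_def multisets_def by (rule large_Times)
    \<comment> \<open>Lowering one \<beta> to v yields infinitely many successive blocks, enough for
      any number of sets in the cover D below.\<close>
    let ?w = "add_mset x (add_mset v (replicate_mset (?n + 1) \<beta>))"
    have "(?w, add_mset x (replicate_mset (?n + 2) \<beta>)) \<in> mstep R"
      using mstep_add_mset[OF mstepI[OF v, of "replicate_mset (?n + 1) \<beta>"]] by simp
    from largeD[OF lC this] obtain Bs :: "nat \<Rightarrow> _" where Bs: "\<And>i. Bs i \<subseteq> C m"
        "\<And>i. large (prod_le ?emb ?emb) (mstep R) ?w (Bs i)"
        "\<And>i j. i < j \<Longrightarrow> precedes (prod_le ?emb ?emb) (Bs i) (Bs j)"
      by metis
    obtain D where D: "finite D" "multisets (T m) \<subseteq> \<Union>D" "\<forall>Y\<in>D. piece ?emb R x Y"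
      using x(1) unfolding covered_def by (elim exE conjE)
    let ?F = "\<lambda>Y. {M \<in> ?A. filter_mset (\<lambda>x. x \<in> T m) M \<in> Y}"
    let ?H = "{M. set_mset M \<subseteq> S m \<and> size M \<le> ?n}"
    have pS: "piece le R \<beta> (S m)" using pQ by (rule piece_subset) (auto simp: S_def)
    have pieceF: "piece ?emb (mstep R) ?w (?F Y)" if Y: "Y \<in> D" for Y
    proof -
      let ?le = "prod_le ?emb (prod_le ((\<le>) :: nat \<Rightarrow> nat \<Rightarrow> bool) ?emb)"
      \<comment> \<open>The exponent consists of x for the part over \<open>T m\<close>, \<beta> for
        the number of elements in \<open>E\<close>, and \<open>?n\<close> times \<beta> for the part
        over \<open>S m\<close>; adding v turns it into \<open>?w\<close>.\<close>
      have P0: "piece ?le (mstep R) (add_mset x (add_mset \<beta> (replicate_mset ?n \<beta>))) (Y \<times> (UNIV \<times> ?H))"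
        using D(3) Y by (intro piece_Times piece_nat[OF v] piece_multisets_bounded[OF pS v]) auto
      have P: "piece ?le (mstep R) ?w (Y \<times> (UNIV \<times> ?H))"
        using piece_add_mset[OF P0, of v] by (simp add: add_mset_commute[of v x])
      show ?thesis
      proof (rule piece_reflect[OF P, where f = "\<lambda>M. (filter_mset (\<lambda>x. x \<in> T m) M,
            (size (filter_mset (\<lambda>x. x \<in> E) M), filter_mset (\<lambda>x. x \<in> S m) M))"])
        have "size (filter_mset (\<lambda>x. x \<in> S m) M) \<le> ?n" if M: "M \<in> ?A" for M
        proof (rule ccontr)
          assume "\<not> ?thesis"
          then have "?emb m (filter_mset (\<lambda>x. x \<in> S m) M)"
            by (intro mset_emb_all) (auto simp: S_def)
          then have "?emb m M" by (rule mset_emb_mono) simp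
          then show False using M by (simp add: residual_def)
        qed
        then show "(\<lambda>M. (filter_mset (\<lambda>x. x \<in> T m) M, (size (filter_mset (\<lambda>x. x \<in> E) M),
            filter_mset (\<lambda>x. x \<in> S m) M))) ` ?F Y \<subseteq> Y \<times> (UNIV \<times> ?H)"
          by auto
        fix M N assume M: "M \<in> ?F Y" and N: "N \<in> ?F Y" and
          emb: "?le (filter_mset (\<lambda>x. x \<in> T m) M, (size (filter_mset (\<lambda>x. x \<in> E) M), filter_mset (\<lambda>x. x \<in> S m) M))
            (filter_mset (\<lambda>x. x \<in> T m) N, (size (filter_mset (\<lambda>x. x \<in> E) N), filter_mset (\<lambda>x. x \<in> S m) N))"
        have split: "filter_mset (\<lambda>x. x \<in> T m) L + (filter_mset (\<lambda>x. x \<in> E) L + filter_mset (\<lambda>x. x \<in> S m) L) = L"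
          if "L \<in> ?F Y" for L
        proof (rule multiset_eqI)
          fix z
          show "count (filter_mset (\<lambda>x. x \<in> T m) L + (filter_mset (\<lambda>x. x \<in> E) L + filter_mset (\<lambda>x. x \<in> S m) L)) z = count L z"
          proof (cases "z \<in># L")
            case True
            then have "z \<in> Q" using that by (auto simp: residual_def multisets_def)
            then show ?thesis by (auto simp: T_def E_def S_def)
          qed (simp add: not_in_iff)
        qed
        have "?emb (filter_mset (\<lambda>x. x \<in> E) M) (filter_mset (\<lambda>x. x \<in> E) N)"
          using emb E by (intro mset_emb_all) (auto simp: prod_le_def)
        then have "?emb (filter_mset (\<lambda>x. x \<in> T m) M + (filter_mset (\<lambda>x. x \<in> E) M + filter_mset (\<lambda>x. x \<in> S m) M))
            (filter_mset (\<lambda>x. x \<in> T m) N + (filter_mset (\<lambda>x. x \<in> E) N + filter_mset (\<lambda>x. x \<in> S m) N))"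
          using emb by (intro mset_emb_union) (auto simp: prod_le_def)
        then show "?emb M N" by (simp only: split[OF M] split[OF N])
      qed
    qed
    have "filter_mset (\<lambda>x. x \<in> T m) M \<in> multisets (T m)" for M by (auto simp: multisets_def)
    then have cover: "?A \<subseteq> \<Union>(?F ` D)" using D(2) by blast
    show "dominated ?emb (prod_le ?emb ?emb) ?A (C m)"
      by (rule dominated_if_blocks[OF wf_mstep[OF R(1)] finite_imageI[OF D(1)] cover, where w = ?w and Bs = Bs])
         (use pieceF Bs in auto)
  qed
qed

text \<open>Otherwise all bad sequences would have length one and the constant 0 would rank
  them.\<close>

lemma exists_not_le:
  assumes "almost_full_on le Q" "natLeq_on 1 <o max_order_type Q le"
  shows "\<exists>a\<in>Q. \<exists>b\<in>Q. \<not> le b a"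
proof (rule ccontr)
  assume *: "\<not> ?thesis"
  have "length s = 1" if s: "s \<in> bad_seqs Q le" for s
  proof -
    have "\<not> (0 < (1 :: nat) \<and> 1 < length s)"
    proof
      assume "0 < (1 :: nat) \<and> 1 < length s"
      then have "\<not> le (s ! 0) (s ! 1)" "s ! 0 \<in> Q" "s ! 1 \<in> Q"
        using s by (auto simp: bad_seqs_def)
      then show False using * by blast
    qed
    moreover have "s \<noteq> []" using s by (simp add: bad_seqs_def)
    ultimately show ?thesis by (cases s) auto
  qed
  then have "\<not> strict_prefix s t" if "s \<in> bad_seqs Q le" "t \<in> bad_seqs Q le" for s t
    using prefix_length_less[of s t] that by auto
  then have "ranks_into (bad_seqs Q le) (natLeq_on 1)"
    unfolding ranks_into_def using natLeq_on_Well_order[of 1]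
    by (intro conjI exI[of _ "\<lambda>_. 0"]) (auto simp: Field_def)
  then have "max_order_type Q le \<le>o natLeq_on 1"
    unfolding max_order_type_def by (rule tree_rank_least(2)[OF bad_seqs_no_infinite_branch[OF assms(1)]])
  then show False using not_ordLess_ordLeq[OF assms(2)] by simp
qed

theorem theorem4p27:
  fixes Q :: "'a set" and le :: "'a \<Rightarrow> 'a \<Rightarrow> bool"
  assumes "well_quasi_order_on Q le"
  shows "ord_width (ltrees Q) (tree_emb le) =o max_order_type (ltrees Q) (tree_emb le) \<and>
    (natLeq_on 1 <o max_order_type Q le \<longrightarrow>
       ord_width (lists Q) (list_emb le) =o max_order_type (lists Q) (list_emb le)) \<and>
    (natLeq_on 1 <o max_order_type Q le \<and> additive_principal (max_order_type Q le) \<longrightarrow>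
       ord_width (multisets Q) (mset_emb le) =o max_order_type (multisets Q) (mset_emb le))"
proof -
  have af: "almost_full_on le Q" using assms by (rule well_quasi_order_on_almost_full_on)
  show ?thesis
  proof (intro conjI impI)
    show "ord_width (ltrees Q) (tree_emb le) =o max_order_type (ltrees Q) (tree_emb le)"
      using af by (rule ord_width_ltrees)
    show "ord_width (lists Q) (list_emb le) =o max_order_type (lists Q) (list_emb le)"
      if one: "natLeq_on 1 <o max_order_type Q le"
      using exists_not_le[OF af one] ord_width_lists[OF af] by (elim bexE) simp
    show "ord_width (multisets Q) (mset_emb le) =o max_order_type (multisets Q) (mset_emb le)"
      if "natLeq_on 1 <o max_order_type Q le \<and> additive_principal (max_order_type Q le)"
      using exists_not_le[OF af] ord_width_multisets[OF assms] that by (elim conjE) metis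
  qed
qed

end
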